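(* Let $d\ge 1$ and $n\ge 1$ be natural numbers, let $Z_d$ be a standard normal random vector in $\mathbb{R}^d$, and let $X_1,\dots,X_n$ be any independent spherically invariant random vectors in $\mathbb{R}^d$, which are also independent of $Z_d$. Then $$\mathsf{P}(\|X_1+\dots+X_n\|>u)<\frac{2e^3}{9}\,\mathsf{P}\Big(\sqrt{\|X_1\|^2+\dots+\|X_n\|^2}\;\|Z_d\|>u\Big)$$ for all real $u$.
   Context: $\|x\|:=\sqrt{x\cdot x}$ is the Euclidean norm on $\mathbb{R}^d$, where $x\cdot y$ is the standard inner product. A random vector $X$ in $\mathbb{R}^d$ is spherically invariant if its distribution is invariant under all orthogonal transformations of $\mathbb{R}^d$; equivalently, for $U$ uniformly distributed on the unit sphere $S^{d-1}$ in $\mathbb{R}^d$, the conditional distribution of $X$ given $\|X\|=r$ is that of $rU$.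
   Formalization: For u ≥ 0 it is additionally assumed that X_1, …, X_n are not all almost surely zero, since otherwise both probabilities are 0 and the strict inequality fails. *)

theory Defs
  imports "HOL-Probability.Probability"
begin

definition spherically_invariant :: "'a measure \<Rightarrow> ('a \<Rightarrow> real ^ 'd) \<Rightarrow> bool" where
  "spherically_invariant M X \<longleftrightarrow>
     X \<in> borel_measurable M \<and>
     (\<forall>T. orthogonal_transformation T \<longrightarrow>
        distr M borel (\<lambda>\<omega>. T (X \<omega>)) = distr M borel X)"

definition standard_normal_vector :: "'a measure \<Rightarrow> ('a \<Rightarrow> real ^ 'd) \<Rightarrow> bool" where
  "standard_normal_vector M Z \<longleftrightarrow>
     prob_space.indep_vars M (\<lambda>_. borel) (\<lambda>i \<omega>. Z \<omega> $ i) UNIV \<and>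
     (\<forall>i. distributed M lborel (\<lambda>\<omega>. Z \<omega> $ i) std_normal_density)"

end

theory Submission
  imports Defs
begin

text \<open>
  The inequality holds conditionally on the summands up to their signs. By spherical invariance and
  independence, replacing some of the vectors \<open>X\<^sub>i\<close> by \<open>- X\<^sub>i\<close> leaves their joint law unchanged.
  Hence the left-hand side is the expectation of the proportion of sign patterns with
  \<open>\<parallel>\<Sum> \<plusminus> X\<^sub>i\<parallel> > u\<close> (\<open>prob_norm_sum_eq_sign_mean\<close>), while by independence of
  \<open>Z\<close> the right-hand side is the expectation of the Gaussian tail with \<open>X\<^sub>1, \<dots>, X\<^sub>n\<close> held fixed
  (\<open>prob_independent_scale\<close>). It remains to compare, for fixed vectors \<open>x\<^sub>i\<close> not all zero, with
  \<open>\<sigma>\<^sup>2 = \<Sum> \<parallel>x\<^sub>i\<parallel>\<^sup>2\<close> and \<open>u \<ge> 0\<close>, the proportion of signs with \<open>\<parallel>\<Sum> \<plusminus> x\<^sub>i\<parallel> > u\<close> and the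
  probability of \<open>\<sigma> \<parallel>Z\<parallel> > u\<close> (\<open>sign_mean_tail_less_gaussian\<close>).

  In dimension at least two this comparison has room to spare. The parallelogram law and the
  convexity of \<open>q \<mapsto> cosh (sqrt q)\<close> bound the mean of \<open>cosh (l \<parallel>\<Sum> \<plusminus> x\<^sub>i\<parallel>)\<close> by
  \<open>\<Prod> cosh (l \<parallel>x\<^sub>i\<parallel>) \<le> exp (l\<^sup>2 \<sigma>\<^sup>2 / 2)\<close>, so the proportion is at most
  \<open>2 exp (- u\<^sup>2 / (2 \<sigma>\<^sup>2))\<close>. Two coordinates of \<open>Z\<close> alone have norm exceeding \<open>u / \<sigma>\<close> with
  probability \<open>exp (- u\<^sup>2 / (2 \<sigma>\<^sup>2))\<close>, and \<open>2 < 2 e\<^sup>3 / 9\<close>.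

  In dimension one let \<open>Q\<close> be the upper tail of the standard normal law and \<open>v = u / \<sigma>\<close>. For
  \<open>v \<ge> sqrt 3\<close> the inequality passes from \<open>n - 1\<close> to \<open>n\<close> summands by conditioning on the last sign,
  because \<open>Q ((v - a) / r) + Q ((v + a) / r) \<le> 2 Q v\<close> with \<open>r = sqrt (1 - a\<^sup>2)\<close>
  (\<open>gauss_tail_two_point\<close>, an argument of Bobkov, Goetze and Houdre). For \<open>v \<le> sqrt 3\<close> no
  induction is needed: the proportion is at most \<open>min 1 (1 / v\<^sup>2)\<close> by Chebyshev, and this is
  smaller than \<open>(2 e\<^sup>3 / 9) \<cdot> 2 Q v\<close> (\<open>chebyshev_below_gauss_tail\<close>).
\<close>

section \<open>Averages over random signs\<close>

text \<open>
  The expectation of \<open>f (\<Sum>i\<in>A. \<epsilon>\<^sub>i x\<^sub>i)\<close> for independent uniform signs \<open>\<epsilon>\<^sub>i\<close>; the set \<open>B\<close> is the set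
  of indices with positive sign. A finite sum is used in place of an integral because signs are
  averaged pointwise, with the vectors \<open>x\<^sub>i\<close> fixed.
\<close>

definition sign_mean :: "'i set \<Rightarrow> ('i \<Rightarrow> 'v::ab_group_add) \<Rightarrow> ('v \<Rightarrow> real) \<Rightarrow> real" where
  "sign_mean A x f =
     (\<Sum>B\<in>Pow A. f (\<Sum>i\<in>A. if i \<in> B then x i else - x i)) / 2 ^ card A"

lemma sign_mean_empty [simp]: "sign_mean {} x f = f 0"
  by (simp add: sign_mean_def)

text \<open>
  Conditioning on the sign of \<open>x\<^sub>j\<close>; the exponential and the Gaussian bound below are inductions along
  this recurrence.
\<close>

lemma sign_mean_insert:
  assumes "finite A" "j \<notin> A"
  shows "sign_mean (insert j A) x f =
           (sign_mean A x (\<lambda>s. f (s + x j)) + sign_mean A x (\<lambda>s. f (s - x j))) / 2"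
proof -
  define S where "S B = (\<Sum>i\<in>A. if i \<in> B then x i else - x i)" for B
  have S_insert: "S (insert j B) = S B" for B
    unfolding S_def using assms by (intro sum.cong) auto
  have plus: "(\<Sum>i\<in>insert j A. if i \<in> insert j B then x i else - x i) = S B + x j" for B
    using assms S_insert[of B] by (simp add: S_def add.commute)
  have minus: "(\<Sum>i\<in>insert j A. if i \<in> B then x i else - x i) = S B - x j" if "B \<in> Pow A" for B
    using assms that by (auto simp: S_def)
  have "inj_on (insert j) (Pow A)"
    using assms by (auto simp: inj_on_def)
  moreover have "Pow A \<inter> insert j ` Pow A = {}"
    using assms by auto
  ultimately have "(\<Sum>B\<in>Pow (insert j A). f (\<Sum>i\<in>insert j A. if i \<in> B then x i else - x i))
      = (\<Sum>B\<in>Pow A. f (S B - x j)) + (\<Sum>B\<in>Pow A. f (S B + x j))"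
    using assms(1)
    by (simp only: Pow_insert)
       (subst sum.union_disjoint; simp only: finite_Pow_iff finite_imageI sum.reindex o_def plus minus cong: sum.cong)
  then show ?thesis
    using assms by (simp add: sign_mean_def S_def add_divide_distrib)
qed

lemma sign_mean_mono:
  assumes "\<And>s. f s \<le> g s"
  shows "sign_mean A x f \<le> sign_mean A x g"
  unfolding sign_mean_def by (intro divide_right_mono sum_mono assms) simp

lemma sign_mean_add: "sign_mean A x (\<lambda>s. f s + g s) = sign_mean A x f + sign_mean A x g"
  by (simp add: sign_mean_def sum.distrib add_divide_distrib)

lemma sign_mean_divide: "sign_mean A x (\<lambda>s. f s / c) = sign_mean A x f / c"
  by (simp add: sign_mean_def flip: sum_divide_distrib)

lemma sign_mean_const: "finite A \<Longrightarrow> sign_mean A x (\<lambda>s. c) = c"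
  by (simp add: sign_mean_def card_Pow)

lemma sign_mean_reflect:
  assumes "finite A"
  shows "sign_mean A x (\<lambda>s. f (- s)) = sign_mean A x f"
  using assms
proof (induction A arbitrary: f rule: finite_induct)
  case (insert j A)
  have "sign_mean A x (\<lambda>s. f (- (s + x j))) = sign_mean A x (\<lambda>s. f (s - x j))"
    using insert.IH[of "\<lambda>s. f (s - x j)"] by (simp add: algebra_simps)
  moreover have "sign_mean A x (\<lambda>s. f (- (s - x j))) = sign_mean A x (\<lambda>s. f (s + x j))"
    using insert.IH[of "\<lambda>s. f (s + x j)"] by (simp add: algebra_simps)
  ultimately show ?case
    using insert.hyps by (simp add: sign_mean_insert)
qed simp

lemma sign_mean_two_sided_tail:
  fixes x :: "'i \<Rightarrow> real"
  assumes "finite A" "u \<ge> 0"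
  shows "sign_mean A x (\<lambda>s. of_bool (\<bar>s\<bar> > u)) = 2 * sign_mean A x (\<lambda>s. of_bool (s > u))"
proof -
  have "sign_mean A x (\<lambda>s. of_bool (\<bar>s\<bar> > u)) = sign_mean A x (\<lambda>s. of_bool (s > u) + of_bool (- s > u))"
    using assms(2) by (intro arg_cong[of _ _ "sign_mean A x"]) (auto simp: fun_eq_iff)
  then show ?thesis
    unfolding sign_mean_add using sign_mean_reflect[OF assms(1), of x "\<lambda>s. of_bool (s > u)"] by simp
qed

text \<open>
  This identifies sums in a one-dimensional space with sums of real numbers.
\<close>

lemma sign_mean_linear_image:
  assumes "linear h"
  shows "sign_mean A x (\<lambda>s. f (h s)) = sign_mean A (\<lambda>i. h (x i)) f"
  unfolding sign_mean_def
  by (simp add: linear_sum[OF assms] linear_neg[OF assms] if_distrib[of h] cong: if_cong)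

text \<open>
  Cross terms cancel, so the second moment is additive. The shift \<open>y\<close> makes the induction work.
\<close>

lemma sign_mean_square:
  fixes x :: "'i \<Rightarrow> real"
  assumes "finite A"
  shows "sign_mean A x (\<lambda>s. (s + y)\<^sup>2) = (\<Sum>i\<in>A. (x i)\<^sup>2) + y\<^sup>2"
  using assms
proof (induction A arbitrary: y rule: finite_induct)
  case (insert j A)
  have "sign_mean (insert j A) x (\<lambda>s. (s + y)\<^sup>2)
      = (sign_mean A x (\<lambda>s. (s + (x j + y))\<^sup>2) + sign_mean A x (\<lambda>s. (s + (y - x j))\<^sup>2)) / 2"
    using insert.hyps by (simp add: sign_mean_insert algebra_simps)
  also have "\<dots> = (\<Sum>i\<in>insert j A. (x i)\<^sup>2) + y\<^sup>2"
    unfolding insert.IH sum.insert[OF insert.hyps] by (simp add: power2_eq_square algebra_simps)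
  finally show ?case .
qed simp

section \<open>An exponential tail bound in inner product spaces\<close>

text \<open>
  Convexity of \<open>z \<mapsto> z\<^sup>k\<close> on the nonnegative numbers: spreading two points of fixed sum further apart increases the sum of
  the values.
\<close>

lemma power_spread_mono:
  fixes N c C :: real
  assumes "\<bar>c\<bar> \<le> C" "C \<le> N"
  shows "(N + c) ^ k + (N - c) ^ k \<le> (N + C) ^ k + (N - C) ^ k"
proof (cases "C = 0")
  case False
  with assms have C: "C > 0" by simp
  define t where "t = (C + c) / (2 * C)"
  have t: "0 \<le> t" "t \<le> 1" using assms C by (auto simp: t_def field_simps)
  have tC: "t * (2 * C) = C + c" using C by (simp add: t_def)
  have e1: "N + c = (1 - t) * (N - C) + t * (N + C)"
    using tC by (simp add: algebra_simps)
  have e2: "N - c = t * (N - C) + (1 - t) * (N + C)"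
    using tC by (simp add: algebra_simps)
  have conv: "convex_on {0..} (\<lambda>z::real. z ^ k)"
  proof (rule f''_ge0_imp_convex)
    show "((\<lambda>z. z ^ k) has_real_derivative real k * z ^ (k - 1)) (at z)" for z
      by (auto intro!: derivative_eq_intros)
    show "((\<lambda>z. real k * z ^ (k - 1)) has_real_derivative real k * (real (k - 1) * z ^ (k - 1 - 1))) (at z)" for z
      by (auto intro!: derivative_eq_intros)
  qed auto
  have 1: "(N + c) ^ k \<le> (1 - t) * (N - C) ^ k + t * (N + C) ^ k"
    using convex_onD[OF conv, of t "N - C" "N + C"] t assms C by (simp add: e1)
  have 2: "(N - c) ^ k \<le> t * (N - C) ^ k + (1 - t) * (N + C) ^ k"
    using convex_onD[OF conv, of "1 - t" "N - C" "N + C"] t assms C by (simp add: e2)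
  show ?thesis using add_mono[OF 1 2] by (simp add: algebra_simps)
qed (use assms in auto)

text \<open>
  Since \<open>cosh (sqrt q)\<close> is a power series in \<open>q\<close> with nonnegative coefficients, the preceding
  lemma applies term by term to \<open>q = p\<^sup>2, q\<^sup>2\<close> and to \<open>(A + B)\<^sup>2, (A - B)\<^sup>2\<close>: both pairs have the
  same sum, and the second is spread further apart.
\<close>

lemma cosh_spread_mono:
  fixes p q A B :: real
  assumes squares: "p\<^sup>2 + q\<^sup>2 = (A + B)\<^sup>2 + (A - B)\<^sup>2"
    and gap: "\<bar>p\<^sup>2 - q\<^sup>2\<bar> \<le> 4 * (A * B)"
  shows "cosh p + cosh q \<le> 2 * (cosh A * cosh B)"
proof -
  define N where "N = A\<^sup>2 + B\<^sup>2"
  define c where "c = (p\<^sup>2 - q\<^sup>2) / 2"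
  define C where "C = 2 * (A * B)"
  have eqs: "p\<^sup>2 = N + c" "q\<^sup>2 = N - c" "(A + B)\<^sup>2 = N + C" "(A - B)\<^sup>2 = N - C"
    using squares by (auto simp: N_def c_def C_def power2_eq_square field_simps)
  have bounds: "\<bar>c\<bar> \<le> C" "C \<le> N"
    using gap eqs(4) zero_le_power2[of "A - B"] by (auto simp: c_def C_def)
  have "cosh p + cosh q \<le> cosh (A + B) + cosh (A - B)"
  proof (rule sums_le[OF _ sums_add[OF cosh_converges cosh_converges] sums_add[OF cosh_converges cosh_converges]])
    fix n :: nat
    show "(if even n then p ^ n /\<^sub>R fact n else 0) + (if even n then q ^ n /\<^sub>R fact n else 0)
        \<le> (if even n then (A + B) ^ n /\<^sub>R fact n else 0) + (if even n then (A - B) ^ n /\<^sub>R fact n else 0)"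
    proof (cases "even n")
      case True
      then obtain k where n: "n = 2 * k" by (elim evenE)
      show ?thesis
        using power_spread_mono[OF bounds, of k] True
        unfolding n power_mult eqs by (simp add: divide_right_mono flip: distrib_left)
    qed simp
  qed
  also have "\<dots> = 2 * (cosh A * cosh B)"
    by (simp add: cosh_add cosh_diff)
  finally show ?thesis .
qed

text \<open>
  The parallelogram law fixes the sum of \<open>\<parallel>y + x\<parallel>\<^sup>2\<close> and \<open>\<parallel>y - x\<parallel>\<^sup>2\<close>, and Cauchy-Schwarz says that
  their difference is largest for parallel vectors, where the claim is the addition formula.
\<close>

lemma cosh_norm_parallelogram:
  fixes x y :: "'v::real_inner"
  assumes "l \<ge> 0"
  shows "cosh (l * norm (y + x)) + cosh (l * norm (y - x))
         \<le> 2 * (cosh (l * norm y) * cosh (l * norm x))"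
proof (rule cosh_spread_mono)
  have nx: "(norm (y + x))\<^sup>2 = (norm y)\<^sup>2 + (norm x)\<^sup>2 + 2 * (y \<bullet> x)"
    "(norm (y - x))\<^sup>2 = (norm y)\<^sup>2 + (norm x)\<^sup>2 - 2 * (y \<bullet> x)"
    by (simp_all add: power2_norm_eq_inner inner_commute algebra_simps)
  show "(l * norm (y + x))\<^sup>2 + (l * norm (y - x))\<^sup>2 = (l * norm y + l * norm x)\<^sup>2 + (l * norm y - l * norm x)\<^sup>2"
    unfolding power_mult_distrib nx by (simp add: power2_eq_square algebra_simps)
  have "(l * norm (y + x))\<^sup>2 - (l * norm (y - x))\<^sup>2 = l\<^sup>2 * (4 * (y \<bullet> x))"
    unfolding power_mult_distrib nx by (simp add: algebra_simps)
  then have "\<bar>(l * norm (y + x))\<^sup>2 - (l * norm (y - x))\<^sup>2\<bar> = 4 * l\<^sup>2 * \<bar>y \<bullet> x\<bar>"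
    by (simp add: abs_mult)
  also have "\<dots> \<le> 4 * l\<^sup>2 * (norm y * norm x)"
    by (intro mult_left_mono Cauchy_Schwarz_ineq2) simp
  finally show "\<bar>(l * norm (y + x))\<^sup>2 - (l * norm (y - x))\<^sup>2\<bar> \<le> 4 * (l * norm y * (l * norm x))"
    by (simp add: power2_eq_square mult_ac)
qed

text \<open>
  The power series compare term by term, because \<open>2\<^sup>k k! \<le> (2k)!\<close>.
\<close>

lemma cosh_le_exp_half_square: "cosh (t::real) \<le> exp (t\<^sup>2 / 2)"
proof -
  have *: "2 ^ k * fact k \<le> (fact (2 * k) :: real)" for k
  proof (induction k)
    case (Suc k)
    have "2 ^ Suc k * fact (Suc k) = (2 * real (Suc k)) * (2 ^ k * fact k)" by simp
    also have "\<dots> \<le> (2 * real (Suc k)) * fact (2 * k)"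
      by (intro mult_left_mono Suc) auto
    also have "\<dots> \<le> (2 * real (Suc k)) * (real (2 * k + 1) * fact (2 * k))"
      by (intro mult_left_mono) auto
    also have "\<dots> = fact (2 * Suc k)" by (simp add: algebra_simps)
    finally show ?case .
  qed simp
  have "(\<lambda>n. if even n then t ^ n /\<^sub>R fact n else 0) sums cosh t" by (rule cosh_converges)
  then have "(\<lambda>k. t ^ (2 * k) /\<^sub>R fact (2 * k)) sums cosh t"
    by (subst (asm) sums_mono_reindex[of "\<lambda>k. 2 * k", symmetric])
       (auto simp: strict_mono_def elim!: evenE)
  moreover have "(\<lambda>k. (t\<^sup>2 / 2) ^ k /\<^sub>R fact k) sums exp (t\<^sup>2 / 2)" by (rule exp_converges)
  moreover have "t ^ (2 * k) /\<^sub>R fact (2 * k) \<le> (t\<^sup>2 / 2) ^ k /\<^sub>R fact k" for k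
  proof -
    have "t ^ (2 * k) / fact (2 * k) \<le> t ^ (2 * k) / (2 ^ k * fact k)"
      using * by (intro divide_left_mono) auto
    also have "\<dots> = (t\<^sup>2 / 2) ^ k / fact k"
      by (simp add: power_mult power_divide)
    finally show ?thesis by (simp only: real_scaleR_def divide_inverse_commute)
  qed
  ultimately show ?thesis by (rule sums_le[rotated])
qed

lemma sign_mean_cosh_norm_le:
  fixes x :: "'i \<Rightarrow> 'v::real_inner"
  assumes "finite A" "l \<ge> 0"
  shows "sign_mean A x (\<lambda>s. cosh (l * norm (s + y)))
         \<le> exp (l\<^sup>2 * (\<Sum>i\<in>A. (norm (x i))\<^sup>2) / 2) * cosh (l * norm y)"
  using assms(1)
proof (induction A arbitrary: y rule: finite_induct)
  case (insert j A)
  let ?E = "exp (l\<^sup>2 * (\<Sum>i\<in>A. (norm (x i))\<^sup>2) / 2)"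
  have "sign_mean (insert j A) x (\<lambda>s. cosh (l * norm (s + y)))
      = (sign_mean A x (\<lambda>s. cosh (l * norm (s + (y + x j)))) + sign_mean A x (\<lambda>s. cosh (l * norm (s + (y - x j))))) / 2"
    using insert.hyps by (simp add: sign_mean_insert algebra_simps)
  also have "\<dots> \<le> ?E * ((cosh (l * norm (y + x j)) + cosh (l * norm (y - x j))) / 2)"
    using insert.IH[of "y + x j"] insert.IH[of "y - x j"] by (simp add: algebra_simps)
  also have "\<dots> \<le> ?E * (cosh (l * norm y) * exp ((l * norm (x j))\<^sup>2 / 2))"
  proof (intro mult_left_mono)
    have "cosh (l * norm (y + x j)) + cosh (l * norm (y - x j)) \<le> 2 * (cosh (l * norm y) * cosh (l * norm (x j)))"
      by (rule cosh_norm_parallelogram) fact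
    also have "\<dots> \<le> 2 * (cosh (l * norm y) * exp ((l * norm (x j))\<^sup>2 / 2))"
      by (intro mult_left_mono cosh_le_exp_half_square) auto
    finally show "(cosh (l * norm (y + x j)) + cosh (l * norm (y - x j))) / 2 \<le> cosh (l * norm y) * exp ((l * norm (x j))\<^sup>2 / 2)"
      by simp
  qed simp
  also have "\<dots> = exp (l\<^sup>2 * (\<Sum>i\<in>insert j A. (norm (x i))\<^sup>2) / 2) * cosh (l * norm y)"
    using insert.hyps by (simp add: power_mult_distrib distrib_left add_divide_distrib exp_add)
  finally show ?case .
qed simp

text \<open>
  Markov's inequality for \<open>cosh (l \<parallel>s\<parallel>)\<close> with the optimal choice \<open>l = u / \<sigma>\<^sup>2\<close>. The factor 2 comes
  from \<open>cosh t \<ge> exp t / 2\<close>.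
\<close>

lemma sign_mean_norm_tail_le:
  fixes x :: "'i \<Rightarrow> 'v::real_inner"
  assumes "finite A" "u \<ge> 0" and pos: "(\<Sum>i\<in>A. (norm (x i))\<^sup>2) > 0"
  shows "sign_mean A x (\<lambda>s. of_bool (norm s > u)) \<le> 2 * exp (- u\<^sup>2 / (2 * (\<Sum>i\<in>A. (norm (x i))\<^sup>2)))"
proof -
  define V where "V = (\<Sum>i\<in>A. (norm (x i))\<^sup>2)"
  define l where "l = u / V"
  have V: "V > 0" and l: "l \<ge> 0" using assms by (auto simp: V_def l_def)
  have half: "exp (l * u) / 2 \<le> cosh (l * u)"
    by (simp add: cosh_def)
  have "sign_mean A x (\<lambda>s. of_bool (norm s > u)) \<le> sign_mean A x (\<lambda>s. cosh (l * norm (s + 0)) / (exp (l * u) / 2))"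
  proof (rule sign_mean_mono)
    fix s :: 'v
    show "of_bool (norm s > u) \<le> cosh (l * norm (s + 0)) / (exp (l * u) / 2)"
    proof (cases "norm s > u")
      case True
      then have "cosh (l * u) \<le> cosh (l * norm s)"
        using l assms(2) by (simp add: cosh_real_nonneg_le_iff mult_left_mono)
      with half have "exp (l * u) / 2 \<le> cosh (l * norm s)" by linarith
      then show ?thesis using True by (simp add: le_divide_eq)
    qed simp
  qed
  also have "\<dots> \<le> exp (l\<^sup>2 * V / 2) / (exp (l * u) / 2)"
    unfolding sign_mean_divide V_def
    using sign_mean_cosh_norm_le[OF assms(1) l, of x 0] by (intro divide_right_mono) auto
  also have "\<dots> = 2 * exp (l\<^sup>2 * V / 2 - l * u)"
    by (simp add: exp_diff)
  also have "l\<^sup>2 * V / 2 - l * u = - u\<^sup>2 / (2 * V)"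
    using V by (simp add: l_def power2_eq_square field_simps)
  finally show ?thesis by (simp add: V_def)
qed

section \<open>The tail of the standard normal distribution\<close>

text \<open>
  The complement of the distribution function, so that monotonicity and limits are inherited from
  the general theory of distribution functions.
\<close>

definition gauss_tail :: "real \<Rightarrow> real" where
  "gauss_tail v = 1 - cdf std_normal_distribution v"

interpretation std_normal: real_distribution std_normal_distribution
  by (rule real_dist_normal_dist)

lemma continuous_on_std_normal_density: "continuous_on A std_normal_density"
  unfolding std_normal_density_def[abs_def] by (intro continuous_intros) auto

lemma std_normal_interval:
  assumes "a \<le> b"
  shows "measure std_normal_distribution {a<..b} = integral {a..b} std_normal_density"
proof -
  have "(std_normal_density has_integral integral {a..b} std_normal_density) {a..b}"
    by (intro integrable_integral integrable_continuous_interval continuous_on_std_normal_density)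
  then have eq: "(\<integral>\<^sup>+x. indicator {a..b} x * std_normal_density x \<partial>lborel) = integral {a..b} std_normal_density"
    by (intro nn_integral_has_integral_lebesgue) auto
  have "emeasure std_normal_distribution {a<..b} = (\<integral>\<^sup>+x. std_normal_density x * indicator {a<..b} x \<partial>lborel)"
    by (subst emeasure_density) (auto intro!: nn_integral_cong simp: indicator_def)
  also have "\<dots> = (\<integral>\<^sup>+x. indicator {a..b} x * std_normal_density x \<partial>lborel)"
    by (intro nn_integral_cong_AE eventually_mono[OF AE_lborel_singleton[of a]])
       (auto simp: indicator_def)
  finally show ?thesis
    using eq by (simp add: measure_def integral_nonneg integrable_continuous_interval continuous_on_std_normal_density)
qed

lemma DERIV_cdf_std_normal: "DERIV (cdf std_normal_distribution) v :> std_normal_density v"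
proof -
  have "((\<lambda>t. integral {v - 1..t} std_normal_density) has_real_derivative std_normal_density v) (at v within {v - 1..v + 1})"
    by (intro integral_has_real_derivative continuous_on_std_normal_density) auto
  then have "((\<lambda>t. integral {v - 1..t} std_normal_density) has_real_derivative std_normal_density v) (at v)"
    by (subst (asm) at_within_interior) (auto simp: interior_atLeastAtMost_real)
  then have "((\<lambda>t. cdf std_normal_distribution (v - 1) + integral {v - 1..t} std_normal_density) has_real_derivative std_normal_density v) (at v)"
    by (auto intro!: derivative_eq_intros)
  moreover have "\<forall>\<^sub>F t in nhds v. cdf std_normal_distribution t = cdf std_normal_distribution (v - 1) + integral {v - 1..t} std_normal_density"
  proof (rule eventually_nhds_in_open[of "{v - 1<..}", THEN eventually_mono])
    fix t assume "t \<in> {v - 1<..}"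
    then show "cdf std_normal_distribution t = cdf std_normal_distribution (v - 1) + integral {v - 1..t} std_normal_density"
      using std_normal.cdf_diff_eq[of "v - 1" t] std_normal_interval[of "v - 1" t] by simp
  qed auto
  ultimately show ?thesis
    by (simp add: DERIV_cong_ev)
qed

lemma DERIV_gauss_tail [derivative_intros]:
  assumes "(g has_real_derivative g') (at v within S)"
  shows "((\<lambda>t. gauss_tail (g t)) has_real_derivative - std_normal_density (g v) * g') (at v within S)"
  unfolding gauss_tail_def
  using DERIV_diff[OF DERIV_const DERIV_chain2[OF DERIV_cdf_std_normal assms], of 1] by simp

lemma DERIV_std_normal_density:
  "(std_normal_density has_real_derivative - v * std_normal_density v) (at v)"
proof -
  have "((\<lambda>v. (1 / sqrt (2 * pi)) * exp (- v\<^sup>2 / 2)) has_real_derivative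
      (1 / sqrt (2 * pi)) * (exp (- v\<^sup>2 / 2) * (- v))) (at v)"
    by (rule DERIV_cmult) (auto intro!: derivative_eq_intros)
  then show ?thesis
    unfolding std_normal_density_def[abs_def] by (simp add: mult_ac)
qed

lemma gauss_tail_tendsto_0: "(gauss_tail \<longlongrightarrow> 0) at_top"
  unfolding gauss_tail_def[abs_def]
  using tendsto_diff[OF tendsto_const std_normal.cdf_lim_at_top_prob, of 1] by simp

lemma gauss_tail_antimono: "v \<le> w \<Longrightarrow> gauss_tail w \<le> gauss_tail v"
  by (simp add: gauss_tail_def std_normal.cdf_nondecreasing)

text \<open>
  A lower bound for the Mills ratio: the difference of the two sides tends to 0 at infinity and has
  a derivative of the right sign.
\<close>

lemma gauss_tail_ge_mills: "std_normal_density v * (v / (1 + v\<^sup>2)) \<le> gauss_tail v"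
proof -
  define D where "D t = gauss_tail t - std_normal_density t * (t / (1 + t\<^sup>2))" for t
  have nz: "1 + t\<^sup>2 \<noteq> 0" for t :: real by (metis power_one sum_power2_eq_zero_iff zero_neq_one)
  have deriv: "DERIV D t :> - (2 * std_normal_density t / (1 + t\<^sup>2)\<^sup>2)" for t
    unfolding D_def[abs_def]
    apply (rule derivative_eq_intros DERIV_std_normal_density refl nz)+
    using nz[of t] by (simp add: divide_simps) (simp add: power2_eq_square algebra_simps)
  have anti: "D w \<le> D v" if "v \<le> w" for w
    using that by (rule DERIV_nonpos_imp_nonincreasing) (use deriv in \<open>force intro!: divide_nonneg_nonneg\<close>)
  have "((\<lambda>t. std_normal_density t * (t / (1 + t\<^sup>2))) \<longlongrightarrow> 0) at_top"
    unfolding std_normal_density_def by real_asymp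
  then have "(D \<longlongrightarrow> 0) at_top"
    unfolding D_def[abs_def] using tendsto_diff[OF gauss_tail_tendsto_0] by fastforce
  then have "0 \<le> D v"
    by (rule tendsto_upperbound) (auto intro!: eventually_mono[OF eventually_ge_at_top[of v]] anti)
  then show ?thesis by (simp add: D_def)
qed

lemma gauss_tail_pos: "0 < gauss_tail v"
proof -
  define w where "w = max v 1"
  have "0 < std_normal_density w * (w / (1 + w\<^sup>2))"
    by (intro mult_pos_pos divide_pos_pos normal_density_pos) (auto simp: w_def add_pos_nonneg)
  also have "\<dots> \<le> gauss_tail w" by (rule gauss_tail_ge_mills)
  also have "\<dots> \<le> gauss_tail v" by (rule gauss_tail_antimono) (simp add: w_def)
  finally show ?thesis .
qed

text \<open>
  The sum \<open>Q v + Q (- v)\<close> has derivative zero because the density is even, and its limit at infinity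
  is 1.
\<close>

lemma gauss_tail_minus: "gauss_tail (- v) = 1 - gauss_tail v"
proof -
  have "DERIV (\<lambda>t. gauss_tail t + gauss_tail (- t)) t :> 0" for t
    by (auto intro!: derivative_eq_intros simp: std_normal_density_def)
  then have const: "gauss_tail t + gauss_tail (- t) = gauss_tail v + gauss_tail (- v)" for t
    using DERIV_isconst_all[of "\<lambda>t. gauss_tail t + gauss_tail (- t)" t v] by blast
  have "((\<lambda>t. gauss_tail (- t)) \<longlongrightarrow> 1) at_top"
    unfolding gauss_tail_def
    using tendsto_diff[OF tendsto_const filterlim_compose[OF std_normal.cdf_lim_at_bot filterlim_uminus_at_bot_at_top], of 1]
    by simp
  from tendsto_add[OF gauss_tail_tendsto_0 this]
  have "((\<lambda>_::real. gauss_tail v + gauss_tail (- v)) \<longlongrightarrow> 0 + 1) at_top"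
    by (rule Lim_transform_eventually) (intro always_eventually allI const)
  then show ?thesis
    by (simp add: tendsto_const_iff)
qed

lemma std_normal_abs_tail:
  assumes "v \<ge> 0"
  shows "measure std_normal_distribution {z. \<bar>z\<bar> > v} = 2 * gauss_tail v"
proof -
  have "isCont (cdf std_normal_distribution) (- v)"
    by (rule DERIV_isCont[OF DERIV_cdf_std_normal])
  then have null: "measure std_normal_distribution {- v} = 0"
    by (simp add: std_normal.isCont_cdf)
  have eq: "{z. \<bar>z\<bar> > v} = (UNIV - {..v}) \<union> ({..- v} - {- v})"
    using assms by auto
  have "measure std_normal_distribution {z. \<bar>z\<bar> > v}
      = measure std_normal_distribution (UNIV - {..v}) + measure std_normal_distribution ({..- v} - {- v})"
    unfolding eq using assms by (intro std_normal.finite_measure_Union) auto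
  also have "measure std_normal_distribution (UNIV - {..v}) = gauss_tail v"
    using std_normal.prob_compl[of "{..v}"] by (simp add: gauss_tail_def cdf_def)
  also have "measure std_normal_distribution ({..- v} - {- v}) = 1 - gauss_tail (- v)"
    using null by (subst std_normal.finite_measure_Diff) (auto simp: gauss_tail_def cdf_def)
  finally show ?thesis by (simp add: gauss_tail_minus)
qed

text \<open>
  Compare the series \<open>\<Sum> w\<^sup>2\<^sup>k\<^sup>+\<^sup>1 / (2k + 1)\<close> of \<open>artanh w\<close> with the geometric series
  \<open>\<Sum> w\<^sup>2\<^sup>k\<^sup>+\<^sup>1 / 3\<^sup>k\<close>: they agree up to third order and \<open>2k + 1 \<le> 3\<^sup>k\<close>. The proof compares
  derivatives instead. The agreement in third order is the reason for the threshold \<open>sqrt 3\<close> in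
  the next lemmas.
\<close>

lemma artanh_lower_bound:
  assumes "0 \<le> w" "w < (1::real)"
  shows "2 * w / (1 - w\<^sup>2 / 3) \<le> ln (1 + w) - ln (1 - w)"
proof -
  define R where "R t = ln (1 + t) - ln (1 - t) - 2 * t / (1 - t\<^sup>2 / 3)" for t :: real
  have "R 0 \<le> R w"
    using assms(1)
  proof (rule DERIV_nonneg_imp_nondecreasing)
    fix t assume t: "0 \<le> t" "t \<le> w"
    have t2: "t\<^sup>2 < 1" using t assms by (simp add: power_less_one_iff abs_square_less_1)
    have p: "1 - t\<^sup>2 / 3 > 0" "1 + t > 0" "1 - t > 0" using t t2 assms by auto
    define R' where "R' = 2 / (1 - t\<^sup>2) - 2 * (1 + t\<^sup>2 / 3) / (1 - t\<^sup>2 / 3)\<^sup>2"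
    have "DERIV R t :> 1 / (1 + t) + 1 / (1 - t) - (2 * (1 - t\<^sup>2 / 3) + 2 * t * (2 * t / 3)) / (1 - t\<^sup>2 / 3)\<^sup>2"
      unfolding R_def[abs_def] using p
      by (auto intro!: derivative_eq_intros simp: power2_eq_square)
    also have "1 / (1 + t) + 1 / (1 - t) = 2 / (1 - t\<^sup>2)"
      using p t2 by (simp add: field_simps power2_eq_square)
    also have "2 * (1 - t\<^sup>2 / 3) + 2 * t * (2 * t / 3) = 2 * (1 + t\<^sup>2 / 3)"
      by (simp add: power2_eq_square)
    finally have "DERIV R t :> R'" by (simp add: R'_def)
    moreover have "R' \<ge> 0"
    proof -
      have "(1 + t\<^sup>2 / 3) * (1 - t\<^sup>2) \<le> (1 - t\<^sup>2 / 3)\<^sup>2"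
        using zero_le_power[of "t\<^sup>2" 2] by (simp add: power2_eq_square algebra_simps)
      then have "(1 + t\<^sup>2 / 3) / (1 - t\<^sup>2 / 3)\<^sup>2 \<le> 1 / (1 - t\<^sup>2)"
        using p t2 by (subst frac_le_eq) (auto intro!: divide_nonpos_pos mult_pos_pos)
      then show ?thesis unfolding R'_def by (simp only: times_divide_eq_right[symmetric])
    qed
    ultimately show "\<exists>y. DERIV R t :> y \<and> 0 \<le> y" by blast
  qed
  then show ?thesis by (simp add: R_def)
qed

text \<open>
  The two densities have ratio \<open>exp (2 w / (1 - a\<^sup>2))\<close> with \<open>w = u a\<close>. As \<open>a\<^sup>2 \<le> w\<^sup>2 / 3\<close>, the bound on
  \<open>artanh w\<close> shows that this is at most \<open>(1 + w) / (1 - w)\<close> if \<open>w < 1\<close>;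
  otherwise the left-hand side is not positive.
\<close>

lemma std_normal_density_ratio_le:
  assumes "u \<ge> sqrt 3" "0 \<le> a" "a < 1"
  shows "(1 - u * a) * std_normal_density ((u - a) / sqrt (1 - a\<^sup>2))
         \<le> (1 + u * a) * std_normal_density ((u + a) / sqrt (1 - a\<^sup>2))"
proof (cases "u * a < 1")
  case True
  define w where "w = u * a"
  have u: "u > 0" "u\<^sup>2 \<ge> 3"
    using assms by (auto intro: order.strict_trans2[of _ "sqrt 3"] simp: real_le_lsqrt real_sqrt_le_iff sqrt_le_D)
  have w: "0 \<le> w" "w < 1" using True u assms by (auto simp: w_def)
  have a2: "a\<^sup>2 < 1" using assms by (simp add: power_less_one_iff abs_square_less_1)
  have "3 * a\<^sup>2 \<le> u\<^sup>2 * a\<^sup>2" using u by (intro mult_right_mono) auto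
  then have aw: "a\<^sup>2 \<le> w\<^sup>2 / 3" by (simp add: w_def power_mult_distrib)
  have w2: "w\<^sup>2 < 1" using w by (simp add: power_less_one_iff abs_square_less_1)
  have "2 * w / (1 - a\<^sup>2) \<le> 2 * w / (1 - w\<^sup>2 / 3)"
    using aw w w2 a2 by (intro divide_left_mono) auto
  also have "\<dots> \<le> ln (1 + w) - ln (1 - w)" by (rule artanh_lower_bound) (use w in auto)
  finally have "exp (ln (1 - w) + 2 * w / (1 - a\<^sup>2)) \<le> exp (ln (1 + w))" by simp
  then have key: "(1 - w) * exp (2 * w / (1 - a\<^sup>2)) \<le> 1 + w"
    using w by (simp add: exp_add)
  have sq: "((u - a) / sqrt (1 - a\<^sup>2))\<^sup>2 = ((u + a) / sqrt (1 - a\<^sup>2))\<^sup>2 - 4 * w / (1 - a\<^sup>2)"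
  proof -
    have "(u - a)\<^sup>2 = (u + a)\<^sup>2 - 4 * w" by (simp add: w_def power2_eq_square algebra_simps)
    then show ?thesis using a2 by (simp only: power_divide) (simp add: diff_divide_distrib)
  qed
  have "std_normal_density ((u - a) / sqrt (1 - a\<^sup>2))
      = std_normal_density ((u + a) / sqrt (1 - a\<^sup>2)) * exp (2 * w / (1 - a\<^sup>2))"
    proof -
    have e: "- (x - 4 * w / k) / 2 = - x / 2 + 2 * w / k" for x k :: real
      by (simp add: diff_divide_distrib)
    show ?thesis unfolding std_normal_density_def sq e exp_add by simp
  qed
  then show ?thesis
    using mult_right_mono[OF key, of "std_normal_density ((u + a) / sqrt (1 - a\<^sup>2))"]
    by (simp add: w_def mult_ac)
next
  case False
  then have "(1 - u * a) * std_normal_density ((u - a) / sqrt (1 - a\<^sup>2)) \<le> 0"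
    by (intro mult_nonpos_nonneg) auto
  also have "0 \<le> (1 + u * a) * std_normal_density ((u + a) / sqrt (1 - a\<^sup>2))"
    using False by (intro mult_nonneg_nonneg) auto
  finally show ?thesis .
qed

text \<open>
  The left-hand side equals the right-hand side at \<open>a = 0\<close> and decreases in \<open>a\<close>; the sign of its
  derivative is the preceding inequality between densities.
\<close>

lemma gauss_tail_two_point_nonneg:
  assumes u: "u \<ge> sqrt 3" and a: "0 \<le> a" "a < 1"
  shows "gauss_tail ((u - a) / sqrt (1 - a\<^sup>2)) + gauss_tail ((u + a) / sqrt (1 - a\<^sup>2)) \<le> 2 * gauss_tail u"
proof -
  define F where "F t = gauss_tail ((u - t) / sqrt (1 - t\<^sup>2)) + gauss_tail ((u + t) / sqrt (1 - t\<^sup>2))" for t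
  have "F a \<le> F 0"
    using a(1)
  proof (rule DERIV_nonpos_imp_nonincreasing)
    fix t assume t: "0 \<le> t" "t \<le> a"
    have t2: "t\<^sup>2 < 1" using t a by (simp add: power_less_one_iff abs_square_less_1)
    define r where "r = sqrt (1 - t\<^sup>2)"
    have r: "r > 0" "r\<^sup>2 = 1 - t\<^sup>2" using t2 by (auto simp: r_def)
    have "((\<lambda>t. 1 - t\<^sup>2) has_real_derivative - 2 * t) (at t)"
      by (auto intro!: derivative_eq_intros)
    from DERIV_chain2[OF DERIV_real_sqrt this]
    have dr: "((\<lambda>t. sqrt (1 - t\<^sup>2)) has_real_derivative - t / r) (at t)"
      using t2 by (simp add: r_def inverse_eq_divide)
    have nonzero: "sqrt (1 - t\<^sup>2) \<noteq> 0" using r by (simp add: r_def)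
    have "((\<lambda>t. u - t) has_real_derivative - 1) (at t)" "((\<lambda>t. u + t) has_real_derivative 1) (at t)"
      by (auto intro!: derivative_eq_intros)
    note quotients = this[THEN DERIV_divide, OF dr nonzero, folded r_def]
    have "(- 1 * r - (u - t) * (- t / r)) / (r * r) = (- (r\<^sup>2) + (u - t) * t) / r ^ 3"
      using r(1) by (simp add: field_simps power2_eq_square power3_eq_cube)
    also have "\<dots> = (u * t - 1) / r ^ 3"
      unfolding r by (simp add: power2_eq_square algebra_simps)
    finally have d1: "((\<lambda>t. (u - t) / sqrt (1 - t\<^sup>2)) has_real_derivative (u * t - 1) / r ^ 3) (at t)"
      using quotients(1) by simp
    have "(1 * r - (u + t) * (- t / r)) / (r * r) = (r\<^sup>2 + (u + t) * t) / r ^ 3"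
      using r(1) by (simp add: field_simps power2_eq_square power3_eq_cube)
    also have "\<dots> = (u * t + 1) / r ^ 3"
      unfolding r by (simp add: power2_eq_square algebra_simps)
    finally have d2: "((\<lambda>t. (u + t) / sqrt (1 - t\<^sup>2)) has_real_derivative (u * t + 1) / r ^ 3) (at t)"
      using quotients(2) by simp
    have "DERIV F t :> - std_normal_density ((u - t) / r) * ((u * t - 1) / r ^ 3)
                     + - std_normal_density ((u + t) / r) * ((u * t + 1) / r ^ 3)"
      unfolding F_def[abs_def] r_def
      using DERIV_add[OF DERIV_gauss_tail[OF d1] DERIV_gauss_tail[OF d2]] by (simp add: r_def)
    also have "- std_normal_density ((u - t) / r) * ((u * t - 1) / r ^ 3) + - std_normal_density ((u + t) / r) * ((u * t + 1) / r ^ 3)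
      = ((1 - u * t) * std_normal_density ((u - t) / r) - (1 + u * t) * std_normal_density ((u + t) / r)) / r ^ 3"
      by (simp add: algebra_simps diff_divide_distrib add_divide_distrib)
    finally have "DERIV F t :> ((1 - u * t) * std_normal_density ((u - t) / r) - (1 + u * t) * std_normal_density ((u + t) / r)) / r ^ 3" .
    moreover have "((1 - u * t) * std_normal_density ((u - t) / r) - (1 + u * t) * std_normal_density ((u + t) / r)) / r ^ 3 \<le> 0"
      using std_normal_density_ratio_le[OF u t(1)] t a r(1)
      by (intro divide_nonpos_nonneg) (auto simp: r_def)
    ultimately show "\<exists>y. DERIV F t :> y \<and> y \<le> 0" by blast
  qed
  then show ?thesis by (simp add: F_def)
qed

lemma gauss_tail_two_point:
  assumes "u \<ge> sqrt 3" "\<bar>a\<bar> < 1"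
  shows "gauss_tail ((u - a) / sqrt (1 - a\<^sup>2)) + gauss_tail ((u + a) / sqrt (1 - a\<^sup>2)) \<le> 2 * gauss_tail u"
  using gauss_tail_two_point_nonneg[OF assms(1), of "\<bar>a\<bar>"] assms(2)
  by (cases "a \<ge> 0") (auto simp: add.commute)

text \<open>
  Up to a constant factor, the right-hand side is \<open>u\<^sup>2\<close> times the Mills bound for the normal tail. Its
  derivative has the sign of \<open>3 - u\<^sup>4\<close>, so on the interval it is smallest at an endpoint.
\<close>

lemma mills_profile_ge_endpoints:
  assumes "1 \<le> u" "u \<le> sqrt 3"
  shows "min (exp (- 1 / 2) / 2) (3 * sqrt 3 / 4 * exp (- 3 / 2)) \<le> u ^ 3 / (1 + u\<^sup>2) * exp (- u\<^sup>2 / 2)"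
proof -
  define m where "m t = t ^ 3 / (1 + t\<^sup>2) * exp (- t\<^sup>2 / 2)" for t :: real
  define m' where "m' t = exp (- t\<^sup>2 / 2) * (t\<^sup>2 / (1 + t\<^sup>2)\<^sup>2) * (3 - t ^ 4)" for t :: real
  have nz: "1 + t\<^sup>2 \<noteq> 0" for t :: real by (metis power_one sum_power2_eq_zero_iff zero_neq_one)
  have deriv: "DERIV m t :> m' t" for t
  proof -
    have "DERIV (\<lambda>t. t ^ 3) t :> 3 * t\<^sup>2" "DERIV (\<lambda>t. 1 + t\<^sup>2) t :> 2 * t"
      by (auto intro!: derivative_eq_intros)
    note quotient = DERIV_divide[OF this nz]
    have exponential: "DERIV (\<lambda>t. exp (- t\<^sup>2 / 2)) t :> exp (- t\<^sup>2 / 2) * - t"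
      by (auto intro!: derivative_eq_intros)
    have poly: "(3 * t\<^sup>2 * (1 + t\<^sup>2) - t ^ 3 * (2 * t)) - t * t ^ 3 * (1 + t\<^sup>2) = t\<^sup>2 * (3 - t ^ 4)"
      by (simp add: eval_nat_numeral algebra_simps)
    have "(3 * t\<^sup>2 * (1 + t\<^sup>2) - t ^ 3 * (2 * t)) / ((1 + t\<^sup>2) * (1 + t\<^sup>2)) - t * t ^ 3 / (1 + t\<^sup>2)
        = ((3 * t\<^sup>2 * (1 + t\<^sup>2) - t ^ 3 * (2 * t)) - t * t ^ 3 * (1 + t\<^sup>2)) / (1 + t\<^sup>2)\<^sup>2"
      using nz[of t] by (simp add: diff_divide_distrib power2_eq_square[of "1 + t\<^sup>2"])
    also have "\<dots> = t\<^sup>2 * (3 - t ^ 4) / (1 + t\<^sup>2)\<^sup>2" unfolding poly ..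
    finally have eq: "(3 * t\<^sup>2 * (1 + t\<^sup>2) - t ^ 3 * (2 * t)) / ((1 + t\<^sup>2) * (1 + t\<^sup>2)) - t * t ^ 3 / (1 + t\<^sup>2)
        = t\<^sup>2 * (3 - t ^ 4) / (1 + t\<^sup>2)\<^sup>2" .
    have factor: "q * E + E * - t * s = E * (q - t * s)" for q E s :: real
      by (simp add: algebra_simps)
    show ?thesis
      using DERIV_mult[OF quotient exponential] eq
      unfolding m_def[abs_def] m'_def factor by (simp add: mult.assoc)
  qed
  show ?thesis
  proof (cases "u ^ 4 \<le> 3")
    case True
    have "m 1 \<le> m u"
      using assms(1)
    proof (rule DERIV_nonneg_imp_nondecreasing)
      fix t :: real assume "1 \<le> t" "t \<le> u"
      then have "t ^ 4 \<le> u ^ 4" by (intro power_mono) auto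
      then show "\<exists>y. DERIV m t :> y \<and> 0 \<le> y"
        using deriv[of t] True by (auto simp: m'_def intro!: exI[of _ "m' t"] mult_nonneg_nonneg)
    qed
    then show ?thesis by (intro min.coboundedI1) (simp add: m_def)
  next
    case False
    have "m (sqrt 3) \<le> m u"
      using assms(2)
    proof (rule DERIV_nonpos_imp_nonincreasing)
      fix t :: real assume "u \<le> t" "t \<le> sqrt 3"
      then have "u ^ 4 \<le> t ^ 4" using assms by (intro power_mono) auto
      then have "m' t \<le> 0"
        unfolding m'_def using False by (intro mult_nonneg_nonpos mult_nonneg_nonneg) auto
      then show "\<exists>y. DERIV m t :> y \<and> y \<le> 0"
        using deriv[of t] by blast
    qed
    then show ?thesis by (intro min.coboundedI2) (simp add: m_def power3_eq_cube)
  qed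
qed

lemma exp_1_ge: "27 / 10 \<le> exp (1::real)"
  using e_approx_32 by (simp add: abs_if split: if_splits)

lemma tail_constant_greater_2: "2 < 2 * exp (3::real) / 9"
proof -
  have "(27 / 10) ^ 3 \<le> exp (1::real) ^ 3"
    by (intro power_mono exp_1_ge) auto
  then have "(27 / 10) ^ 3 \<le> exp (3::real)"
    by (simp flip: exp_of_nat_mult)
  then show ?thesis by (simp add: eval_nat_numeral)
qed

text \<open>
  By the previous lemma only the endpoints matter; there the claim becomes \<open>81 \<pi> < 2 e\<^sup>5\<close> and
  \<open>6 \<pi> < e\<^sup>3\<close>.
\<close>

lemma chebyshev_below_gauss_tail:
  assumes "1 \<le> u" "u \<le> sqrt 3"
  shows "1 / u\<^sup>2 < 2 * (2 * exp 3 / 9) * gauss_tail u"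
proof -
  have pi: "pi \<le> 315 / 100" using pi_approx by auto
  define c :: real where "c = 2 * (2 * exp 3 / 9) / sqrt (2 * pi)"
  have sq_less: "y < x" if "y\<^sup>2 < x\<^sup>2" "x \<ge> 0" for x y :: real
    using that by (rule power2_less_imp_less)
  have "c * (exp (- 1 / 2) / 2) > 1"
  proof -
    have "9 * sqrt (2 * pi) < 2 * exp (5 / 2)"
    proof (rule sq_less)
      have "(9 * sqrt (2 * pi))\<^sup>2 = 162 * pi" by (simp add: power_mult_distrib)
      also have "\<dots> < 4 * (27 / 10) ^ 5" using pi by (simp add: eval_nat_numeral)
      also have "\<dots> \<le> 4 * exp 1 ^ 5" using exp_1_ge by (intro mult_left_mono power_mono) auto
      also have "\<dots> = (2 * exp (5 / 2))\<^sup>2" by (simp add: power_mult_distrib flip: exp_of_nat_mult)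
      finally show "(9 * sqrt (2 * pi))\<^sup>2 < (2 * exp (5 / 2))\<^sup>2" .
    qed simp
    also have "exp (5 / 2) = exp 3 * exp (- 1 / 2 :: real)" by (simp flip: exp_add)
    finally show ?thesis by (simp add: c_def field_simps)
  qed
  moreover have "c * (3 * sqrt 3 / 4 * exp (- 3 / 2)) > 1"
  proof -
    have "sqrt 3 * sqrt (2 * pi) < exp (3 / 2)"
    proof (rule sq_less)
      have "(sqrt 3 * sqrt (2 * pi))\<^sup>2 = 6 * pi" by (simp add: power_mult_distrib)
      also have "\<dots> < (27 / 10) ^ 3" using pi by (simp add: eval_nat_numeral)
      also have "\<dots> \<le> exp 1 ^ 3" using exp_1_ge by (intro power_mono) auto
      also have "\<dots> = (exp (3 / 2))\<^sup>2" by (simp flip: exp_of_nat_mult)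
      finally show "(sqrt 3 * sqrt (2 * pi))\<^sup>2 < (exp (3 / 2))\<^sup>2" .
    qed simp
    then have "1 < exp (3 / 2) / (sqrt 3 * sqrt (2 * pi))" by simp
    also have "\<dots> = sqrt 3 / 3 * exp (3 / 2) / sqrt (2 * pi)"
      by (simp add: field_simps)
    also have "exp (3 / 2) = exp 3 * exp (- 3 / 2 :: real)" by (simp flip: exp_add)
    finally show ?thesis by (simp add: c_def field_simps)
  qed
  ultimately have "1 < c * min (exp (- 1 / 2) / 2) (3 * sqrt 3 / 4 * exp (- 3 / 2))"
    by (auto simp: min_def)
  also have "\<dots> \<le> c * (u ^ 3 / (1 + u\<^sup>2) * exp (- u\<^sup>2 / 2))"
    by (intro mult_left_mono mills_profile_ge_endpoints assms) (simp add: c_def)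
  also have "\<dots> = 2 * (2 * exp 3 / 9) * (std_normal_density u * (u / (1 + u\<^sup>2))) * u\<^sup>2"
    by (simp add: c_def std_normal_density_def power3_eq_cube power2_eq_square mult_ac)
  also have "\<dots> \<le> 2 * (2 * exp 3 / 9) * gauss_tail u * u\<^sup>2"
    by (intro mult_left_mono mult_right_mono gauss_tail_ge_mills) auto
  finally show ?thesis using assms by (simp add: divide_less_eq)
qed

section \<open>The comparison for sums of real numbers with random signs\<close>

text \<open>
  The additional factor \<open>1 / 2\<close> compared to Chebyshev's inequality is due to symmetry.
\<close>

lemma sign_mean_upper_tail_chebyshev:
  fixes x :: "'i \<Rightarrow> real"
  assumes "finite A" "w > 0"
  shows "sign_mean A x (\<lambda>s. of_bool (s > w)) \<le> (\<Sum>i\<in>A. (x i)\<^sup>2) / w\<^sup>2 / 2"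
proof -
  have "2 * sign_mean A x (\<lambda>s. of_bool (s > w)) = sign_mean A x (\<lambda>s. of_bool (\<bar>s\<bar> > w))"
    using assms by (simp add: sign_mean_two_sided_tail)
  also have "\<dots> \<le> sign_mean A x (\<lambda>s. (s + 0)\<^sup>2 / w\<^sup>2)"
  proof (rule sign_mean_mono)
    fix s :: real
    show "of_bool (\<bar>s\<bar> > w) \<le> (s + 0)\<^sup>2 / w\<^sup>2"
    proof (cases "w < \<bar>s\<bar>")
      case True
      then have "w\<^sup>2 \<le> s\<^sup>2" using assms(2) abs_le_square_iff[of w s] by simp
      then show ?thesis using assms(2) by simp
    qed auto
  qed
  finally show ?thesis
    unfolding sign_mean_divide sign_mean_square[OF assms(1)] by simp
qed

text \<open>
  Induction on the number of summands, as explained at the beginning: below \<open>sqrt 3\<close> standard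
  deviations the bound is a direct one, above it the two-point inequality carries the induction.
\<close>

lemma sign_mean_upper_tail_less:
  fixes x :: "'i \<Rightarrow> real"
  assumes "finite A" "(\<Sum>i\<in>A. (x i)\<^sup>2) > 0" "u \<ge> 0"
  shows "sign_mean A x (\<lambda>s. of_bool (s > u)) < 2 * exp 3 / 9 * gauss_tail (u / sqrt (\<Sum>i\<in>A. (x i)\<^sup>2))"
  using assms
proof (induction A arbitrary: u rule: finite_induct)
  case (insert j A)
  define c :: real where "c = 2 * exp 3 / 9"
  have c: "c > 0" by (simp add: c_def)
  define V where "V = (\<Sum>i\<in>A. (x i)\<^sup>2)"
  define W where "W = (\<Sum>i\<in>insert j A. (x i)\<^sup>2)"
  have WV: "W = V + (x j)\<^sup>2" using insert.hyps by (simp add: W_def V_def)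
  have W: "W > 0" and V: "V \<ge> 0" using insert.prems by (auto simp: W_def V_def sum_nonneg)
  define v where "v = u / sqrt W"
  have v: "v \<ge> 0" and uv: "u = v * sqrt W" using W insert.prems by (auto simp: v_def)
  have fin: "finite (insert j A)" using insert.hyps by simp
  have "sign_mean (insert j A) x (\<lambda>s. of_bool (s > u)) < c * gauss_tail v"
  proof (cases "v \<le> sqrt 3")
    case small: True
    show ?thesis
    proof (cases "v \<ge> 1")
      case True
      then have "u > 0" using uv W by simp
      then have "sign_mean (insert j A) x (\<lambda>s. of_bool (s > u)) \<le> W / u\<^sup>2 / 2"
        using sign_mean_upper_tail_chebyshev[OF fin] unfolding W_def by blast
      also have "\<dots> = 1 / v\<^sup>2 / 2" using W by (simp add: uv power_mult_distrib)
      also have "\<dots> < c * gauss_tail v"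
        using chebyshev_below_gauss_tail[OF True small] by (simp add: c_def)
      finally show ?thesis .
    next
      case False
      have "2 * sign_mean (insert j A) x (\<lambda>s. of_bool (s > u))
          = sign_mean (insert j A) x (\<lambda>s. of_bool (\<bar>s\<bar> > u))"
        using sign_mean_two_sided_tail[OF fin insert.prems(2)] by simp
      also have "\<dots> \<le> sign_mean (insert j A) x (\<lambda>s. 1)"
        by (intro sign_mean_mono) auto
      also have "\<dots> = 1" by (rule sign_mean_const[OF fin])
      also have "1 < 2 * (c * gauss_tail 1)"
        using chebyshev_below_gauss_tail[of 1] by (simp add: c_def)
      also have "\<dots> \<le> 2 * (c * gauss_tail v)"
        using False c by (intro mult_left_mono gauss_tail_antimono) auto
      finally show ?thesis by simp
    qed
  next
    case large: False
    \<comment> \<open>After normalization to unit variance the last summand is \<open>a\<close> and the others have variance \<open>1 - a\<^sup>2\<close>.\<close>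
    define a where "a = x j / sqrt W"
    have xa: "x j = a * sqrt W" using W by (simp add: a_def)
    have "\<bar>x j\<bar> \<le> sqrt W" using V by (simp add: WV real_le_rsqrt)
    then have a1: "\<bar>a\<bar> \<le> 1" using W by (simp add: a_def)
    have "1 < sqrt (3::real)" by simp
    with large have v1: "v > 1" by linarith
    have Va: "V = W * (1 - a\<^sup>2)"
    proof -
      have "(x j)\<^sup>2 = W * a\<^sup>2" unfolding xa power_mult_distrib using W by simp
      with WV show ?thesis by (simp add: right_diff_distrib)
    qed
    have pos: "u - x j > 0" "u + x j > 0"
      using a1 v1 W by (auto simp: uv xa simp flip: left_diff_distrib distrib_right)
    have step: "sign_mean (insert j A) x (\<lambda>s. of_bool (s > u))
      = (sign_mean A x (\<lambda>s. of_bool (s > u - x j)) + sign_mean A x (\<lambda>s. of_bool (s > u + x j))) / 2"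
      using insert.hyps by (simp add: sign_mean_insert algebra_simps)
    show ?thesis
    proof (cases "V = 0")
      \<comment> \<open>Only one summand is nonzero; it is too small to exceed \<open>u\<close>, and the induction hypothesis is void.\<close>
      case True
      then have "sign_mean A x (\<lambda>s. of_bool (s > u - x j)) \<le> 0" "sign_mean A x (\<lambda>s. of_bool (s > u + x j)) \<le> 0"
        using sign_mean_upper_tail_chebyshev[OF insert.hyps(1) pos(1), of x]
          sign_mean_upper_tail_chebyshev[OF insert.hyps(1) pos(2), of x]
        by (simp_all add: V_def)
      moreover have "0 < c * gauss_tail v" using c gauss_tail_pos[of v] by simp
      ultimately show ?thesis unfolding step by simp
    next
      case False
      then have V0: "V > 0" using V by simp
      then have a2: "a\<^sup>2 < 1" using W by (simp add: Va zero_less_mult_iff)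
      then have a_less: "\<bar>a\<bar> < 1" by (simp add: abs_square_less_1)
      have sV: "sqrt V = sqrt W * sqrt (1 - a\<^sup>2)" by (simp add: Va real_sqrt_mult)
      have e: "(u - x j) / sqrt V = (v - a) / sqrt (1 - a\<^sup>2)" "(u + x j) / sqrt V = (v + a) / sqrt (1 - a\<^sup>2)"
        using W unfolding uv xa sV by (simp_all add: mult.commute[of _ "sqrt W"] flip: right_diff_distrib distrib_left)
      have "sign_mean A x (\<lambda>s. of_bool (s > u - x j)) < c * gauss_tail ((v - a) / sqrt (1 - a\<^sup>2))"
        "sign_mean A x (\<lambda>s. of_bool (s > u + x j)) < c * gauss_tail ((v + a) / sqrt (1 - a\<^sup>2))"
        using insert.IH[of "u - x j"] insert.IH[of "u + x j"] V0 pos by (simp_all add: V_def[symmetric] e c_def)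
      moreover have "c * gauss_tail ((v - a) / sqrt (1 - a\<^sup>2)) + c * gauss_tail ((v + a) / sqrt (1 - a\<^sup>2)) \<le> c * (2 * gauss_tail v)"
        using gauss_tail_two_point[of v a] large a_less c by (simp flip: distrib_left)
      ultimately show ?thesis unfolding step by simp
    qed
  qed
  then show ?case by (simp only: c_def v_def W_def)
qed simp

section \<open>Norms of standard normal vectors\<close>

lemma gaussian_radial_tail:
  assumes k: "k > 0" and v: "v \<ge> 0"
  shows "(\<integral>\<^sup>+x. ennreal (\<bar>x\<bar> * exp (- (k * x\<^sup>2) / 2)) * indicator {x. k * x\<^sup>2 > v\<^sup>2} x \<partial>lborel)
         = ennreal (2 / k * exp (- v\<^sup>2 / 2))"
proof -
  define w where "w = v / sqrt k"
  have w: "w \<ge> 0" "k * w\<^sup>2 = v\<^sup>2" using k v by (auto simp: w_def power_divide)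
  define f where "f x = ennreal (x * exp (- (k * x\<^sup>2) / 2)) * indicator {w..} x" for x :: real
  have [measurable]: "f \<in> borel_measurable borel" unfolding f_def by measurable
  have "(\<integral>\<^sup>+x. f x \<partial>lborel) = ennreal (0 - (- (1 / k) * exp (- (k * w\<^sup>2) / 2)))"
    unfolding f_def
  proof (rule nn_integral_FTC_atLeast[where F = "\<lambda>x. - (1 / k) * exp (- (k * x\<^sup>2) / 2)"])
    show "DERIV (\<lambda>x. - (1 / k) * exp (- (k * x\<^sup>2) / 2)) x :> x * exp (- (k * x\<^sup>2) / 2)" for x
      using k by (auto intro!: derivative_eq_intros)
    show "((\<lambda>x. - (1 / k) * exp (- (k * x\<^sup>2) / 2)) \<longlongrightarrow> 0) at_top"
      using k by real_asymp
  qed (use w in auto)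
  then have half: "(\<integral>\<^sup>+x. f x \<partial>lborel) = ennreal (1 / k * exp (- v\<^sup>2 / 2))"
    by (simp add: w)
  have half': "(\<integral>\<^sup>+x. f (- x) \<partial>lborel) = (\<integral>\<^sup>+x. f x \<partial>lborel)"
    using nn_integral_real_affine[of f "-1" 0] by simp
  have iff: "k * x\<^sup>2 > v\<^sup>2 \<longleftrightarrow> \<bar>x\<bar> > w" for x
    unfolding w(2)[symmetric] using k w(1) abs_le_square_iff[of x w] by (auto simp: not_le[symmetric])
  have "(\<integral>\<^sup>+x. ennreal (\<bar>x\<bar> * exp (- (k * x\<^sup>2) / 2)) * indicator {x. k * x\<^sup>2 > v\<^sup>2} x \<partial>lborel)
      = (\<integral>\<^sup>+x. f x + f (- x) \<partial>lborel)"
  proof (rule nn_integral_cong_AE)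
    show "AE x in lborel. ennreal (\<bar>x\<bar> * exp (- (k * x\<^sup>2) / 2)) * indicator {x. k * x\<^sup>2 > v\<^sup>2} x = f x + f (- x)"
      using AE_lborel_singleton[of w] AE_lborel_singleton[of "- w"]
    proof eventually_elim
      case (elim x)
      then show ?case
        using w(1) by (auto simp: f_def iff indicator_def abs_if)
    qed
  qed
  also have "\<dots> = ennreal (1 / k * exp (- v\<^sup>2 / 2)) + ennreal (1 / k * exp (- v\<^sup>2 / 2))"
    by (subst nn_integral_add) (auto simp: half half')
  also have "\<dots> = ennreal (2 / k * exp (- v\<^sup>2 / 2))"
    using k by (simp add: ennreal_plus[symmetric] del: ennreal_plus)
  finally show ?thesis .
qed

text \<open>
  The substitution \<open>y = x s\<close> in the inner integral, followed by an exchange of the integrals, replaces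
  polar coordinates: \<open>s\<close> is the slope, and the integral over \<open>x\<close> is elementary. It shows that the
  probability is \<open>exp (- v\<^sup>2 / 2)\<close> times a constant \<open>C\<close> independent of \<open>v\<close>, and \<open>C = 1\<close> is the case
  \<open>v = 0\<close>.
\<close>

lemma std_normal_plane_tail:
  assumes v: "v \<ge> 0"
  shows "measure (std_normal_distribution \<Otimes>\<^sub>M std_normal_distribution) {p. (fst p)\<^sup>2 + (snd p)\<^sup>2 > v\<^sup>2}
         = exp (- v\<^sup>2 / 2)"
proof -
  let ?N = "std_normal_distribution"
  define T where "T v = emeasure (?N \<Otimes>\<^sub>M ?N) {p. (fst p)\<^sup>2 + (snd p)\<^sup>2 > v\<^sup>2}" for v :: real
  define C where "C = (\<integral>\<^sup>+s. ennreal (2 / (1 + s\<^sup>2)) * ennreal (1 / (2 * pi)) \<partial>lborel)"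
  have plane_set: "{p. (fst p)\<^sup>2 + (snd p)\<^sup>2 > v\<^sup>2} \<in> sets (borel \<Otimes>\<^sub>M borel)" for v :: real
  proof -
    have "(\<lambda>p. (fst p)\<^sup>2 + (snd p)\<^sup>2) \<in> borel_measurable (borel \<Otimes>\<^sub>M borel :: (real \<times> real) measure)"
      by measurable
    from borel_measurable_less[OF borel_measurable_const this, of "v\<^sup>2"] show ?thesis
      by (simp add: space_pair_measure)
  qed
  have sets_NN: "sets (?N \<Otimes>\<^sub>M ?N) = sets (borel \<Otimes>\<^sub>M borel)"
    by (rule sets_pair_measure_cong) auto
  have T: "T v = ennreal (exp (- v\<^sup>2 / 2)) * C" if "v \<ge> 0" for v
  proof -
    let ?I = "\<lambda>x y. indicator {p. (fst p)\<^sup>2 + (snd p)\<^sup>2 > v\<^sup>2} (x, y) :: ennreal"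
    have [measurable]: "(\<lambda>p. indicator {p. (fst p)\<^sup>2 + (snd p)\<^sup>2 > v\<^sup>2} p :: ennreal) \<in> borel_measurable (borel \<Otimes>\<^sub>M borel)"
      using plane_set[of v] by (rule borel_measurable_indicator)
    have "T v = (\<integral>\<^sup>+x. (\<integral>\<^sup>+y. ?I x y \<partial>?N) \<partial>?N)"
      unfolding T_def by (rule std_normal.emeasure_pair_measure) (simp only: sets_NN plane_set)
    also have "\<dots> = (\<integral>\<^sup>+x. ennreal (std_normal_density x) * (\<integral>\<^sup>+y. ennreal (std_normal_density y) * ?I x y \<partial>lborel) \<partial>lborel)"
      by (simp add: nn_integral_density)
    also have "\<dots> = (\<integral>\<^sup>+x. (\<integral>\<^sup>+s. ennreal (\<bar>x\<bar> * exp (- ((1 + s\<^sup>2) * x\<^sup>2) / 2)) *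
         indicator {x. (1 + s\<^sup>2) * x\<^sup>2 > v\<^sup>2} x * ennreal (1 / (2 * pi)) \<partial>lborel) \<partial>lborel)"
    proof (rule nn_integral_cong_AE)
      show "AE x in lborel. ennreal (std_normal_density x) * (\<integral>\<^sup>+y. ennreal (std_normal_density y) * ?I x y \<partial>lborel)
        = (\<integral>\<^sup>+s. ennreal (\<bar>x\<bar> * exp (- ((1 + s\<^sup>2) * x\<^sup>2) / 2)) *
         indicator {x. (1 + s\<^sup>2) * x\<^sup>2 > v\<^sup>2} x * ennreal (1 / (2 * pi)) \<partial>lborel)"
        using AE_lborel_singleton[of 0]
      proof eventually_elim
        case (elim x)
        have "(\<integral>\<^sup>+y. ennreal (std_normal_density y) * ?I x y \<partial>lborel)
            = ennreal \<bar>x\<bar> * (\<integral>\<^sup>+s. ennreal (std_normal_density (0 + x * s)) * ?I x (0 + x * s) \<partial>lborel)"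
          by (rule nn_integral_real_affine) (use elim in auto)
        then have "ennreal (std_normal_density x) * (\<integral>\<^sup>+y. ennreal (std_normal_density y) * ?I x y \<partial>lborel)
            = (\<integral>\<^sup>+s. ennreal (std_normal_density x) * (ennreal \<bar>x\<bar> * (ennreal (std_normal_density (x * s)) * ?I x (x * s))) \<partial>lborel)"
          by (simp add: nn_integral_cmult)
        also have "\<dots> = (\<integral>\<^sup>+s. ennreal (\<bar>x\<bar> * exp (- ((1 + s\<^sup>2) * x\<^sup>2) / 2)) *
         indicator {x. (1 + s\<^sup>2) * x\<^sup>2 > v\<^sup>2} x * ennreal (1 / (2 * pi)) \<partial>lborel)"
        proof (rule nn_integral_cong)
          fix s :: real
          have I: "?I x (x * s) = indicator {x. (1 + s\<^sup>2) * x\<^sup>2 > v\<^sup>2} x"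
            by (auto simp: indicator_def algebra_simps power_mult_distrib)
          have "std_normal_density x * (\<bar>x\<bar> * std_normal_density (x * s))
              = (\<bar>x\<bar> * exp (- ((1 + s\<^sup>2) * x\<^sup>2) / 2)) * (1 / (2 * pi))"
            by (simp add: std_normal_density_def algebra_simps power_mult_distrib add_divide_distrib diff_divide_distrib flip: exp_add)
          then have "ennreal (std_normal_density x) * (ennreal \<bar>x\<bar> * ennreal (std_normal_density (x * s)))
              = ennreal (\<bar>x\<bar> * exp (- ((1 + s\<^sup>2) * x\<^sup>2) / 2)) * ennreal (1 / (2 * pi))"
            by (simp flip: ennreal_mult)
          then show "ennreal (std_normal_density x) * (ennreal \<bar>x\<bar> * (ennreal (std_normal_density (x * s)) * ?I x (x * s)))
            = ennreal (\<bar>x\<bar> * exp (- ((1 + s\<^sup>2) * x\<^sup>2) / 2)) *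
         indicator {x. (1 + s\<^sup>2) * x\<^sup>2 > v\<^sup>2} x * ennreal (1 / (2 * pi))"
            unfolding I by (simp only: mult.assoc[symmetric]) (simp only: mult.assoc mult.commute[of "ennreal (1 / (2 * pi))"])
        qed
        finally show ?case .
      qed
    qed
    also have "\<dots> = (\<integral>\<^sup>+s. (\<integral>\<^sup>+x. ennreal (\<bar>x\<bar> * exp (- ((1 + s\<^sup>2) * x\<^sup>2) / 2)) *
         indicator {x. (1 + s\<^sup>2) * x\<^sup>2 > v\<^sup>2} x * ennreal (1 / (2 * pi)) \<partial>lborel) \<partial>lborel)"
      by (rule lborel_pair.Fubini'[symmetric]) measurable
    also have "\<dots> = (\<integral>\<^sup>+s. ennreal (2 / (1 + s\<^sup>2) * exp (- v\<^sup>2 / 2)) * ennreal (1 / (2 * pi)) \<partial>lborel)"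
    proof (rule nn_integral_cong)
      fix s :: real
      have "1 + s\<^sup>2 > 0" by (simp add: add_pos_nonneg)
      from gaussian_radial_tail[OF this that]
      show "(\<integral>\<^sup>+x. ennreal (\<bar>x\<bar> * exp (- ((1 + s\<^sup>2) * x\<^sup>2) / 2)) *
          indicator {x. (1 + s\<^sup>2) * x\<^sup>2 > v\<^sup>2} x * ennreal (1 / (2 * pi)) \<partial>lborel)
        = ennreal (2 / (1 + s\<^sup>2) * exp (- v\<^sup>2 / 2)) * ennreal (1 / (2 * pi))"
        by (subst nn_integral_multc) simp_all
    qed
    also have "\<dots> = (\<integral>\<^sup>+s. ennreal (exp (- v\<^sup>2 / 2)) * (ennreal (2 / (1 + s\<^sup>2)) * ennreal (1 / (2 * pi))) \<partial>lborel)"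
    proof (rule nn_integral_cong)
      fix s :: real
      have "ennreal (2 / (1 + s\<^sup>2) * exp (- v\<^sup>2 / 2)) = ennreal (2 / (1 + s\<^sup>2)) * ennreal (exp (- v\<^sup>2 / 2))"
        by (rule ennreal_mult) auto
      then show "ennreal (2 / (1 + s\<^sup>2) * exp (- v\<^sup>2 / 2)) * ennreal (1 / (2 * pi))
        = ennreal (exp (- v\<^sup>2 / 2)) * (ennreal (2 / (1 + s\<^sup>2)) * ennreal (1 / (2 * pi)))"
        by (simp only: mult_ac)
    qed
    finally show ?thesis by (simp add: C_def nn_integral_cmult)
  qed
  interpret NN: pair_prob_space ?N ?N ..
  have "T 0 = 1"
  proof -
    have "isCont (cdf ?N) 0" by (rule DERIV_isCont[OF DERIV_cdf_std_normal])
    then have "measure ?N (UNIV - {0}) = 1"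
      using std_normal.prob_compl[of "{0}"] by (simp add: std_normal.isCont_cdf)
    then have "1 = emeasure (?N \<Otimes>\<^sub>M ?N) ((UNIV - {0}) \<times> UNIV)"
      using std_normal.emeasure_space_1
      by (subst std_normal.emeasure_pair_measure_Times) (auto simp: std_normal.emeasure_eq_measure)
    also have "\<dots> \<le> T 0"
      unfolding T_def
    proof (rule emeasure_mono)
      show "(UNIV - {0}) \<times> UNIV \<subseteq> {p :: real \<times> real. (fst p)\<^sup>2 + (snd p)\<^sup>2 > 0\<^sup>2}"
        by (auto intro: add_pos_nonneg)
      show "{p :: real \<times> real. (fst p)\<^sup>2 + (snd p)\<^sup>2 > 0\<^sup>2} \<in> sets (?N \<Otimes>\<^sub>M ?N)"
        by (simp only: sets_NN plane_set)
    qed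
    finally have "1 \<le> T 0" .
    then show ?thesis
      unfolding T_def using NN.emeasure_le_1 by (intro antisym) auto
  qed
  then have "C = 1" using T[of 0] by simp
  then show ?thesis using T[OF v] by (simp add: T_def measure_def)
qed

lemma distr_standard_normal_component:
  assumes "standard_normal_vector M Z"
  shows "(\<lambda>\<omega>. Z \<omega> $ i) \<in> borel_measurable M"
    and "distr M borel (\<lambda>\<omega>. Z \<omega> $ i) = std_normal_distribution"
proof -
  have "distributed M lborel (\<lambda>\<omega>. Z \<omega> $ i) std_normal_density"
    using assms by (simp add: standard_normal_vector_def)
  then show "(\<lambda>\<omega>. Z \<omega> $ i) \<in> borel_measurable M"
    "distr M borel (\<lambda>\<omega>. Z \<omega> $ i) = std_normal_distribution"
    by (auto dest: distributed_distr_eq_density distributed_measurable cong: distr_cong)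
qed

lemma borel_measurable_standard_normal_vector:
  fixes Z :: "'a \<Rightarrow> real ^ 'd"
  assumes "standard_normal_vector M Z"
  shows "Z \<in> borel_measurable M"
  using distr_standard_normal_component(1)[OF assms]
  by (subst borel_measurable_euclidean_space) (auto simp: Basis_vec_def inner_axis)

text \<open>
  In dimension at least two, the norm dominates the norm of two of the coordinates.
\<close>

lemma std_normal_vector_tail_ge:
  fixes Z :: "'a \<Rightarrow> real ^ 'd"
  assumes "prob_space M" and Z: "standard_normal_vector M Z"
    and dim: "CARD('d) \<noteq> 1" and v: "v \<ge> 0"
  shows "exp (- v\<^sup>2 / 2) \<le> measure M {\<omega> \<in> space M. norm (Z \<omega>) > v}"
proof -
  interpret prob_space M by fact
  let ?N = std_normal_distribution
  obtain i j :: 'd where ij: "i \<noteq> j"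
  proof (rule ccontr)
    assume "\<not> thesis"
    with that have "(UNIV :: 'd set) = {undefined}" by auto
    then have "CARD('d) = card {undefined :: 'd}" by simp
    with dim show False by simp
  qed
  have [measurable]: "(\<lambda>\<omega>. Z \<omega> $ k) \<in> borel_measurable M" for k
    by (rule distr_standard_normal_component(1)[OF Z])
  have [measurable]: "Z \<in> borel_measurable M"
    by (rule borel_measurable_standard_normal_vector[OF Z])
  have "indep_vars (\<lambda>_. borel) (\<lambda>i \<omega>. Z \<omega> $ i) UNIV"
    using Z by (simp add: standard_normal_vector_def)
  then have "indep_var (PiM {i} (\<lambda>_. borel)) (\<lambda>\<omega>. restrict (\<lambda>i. Z \<omega> $ i) {i})
                       (PiM {j} (\<lambda>_. borel)) (\<lambda>\<omega>. restrict (\<lambda>i. Z \<omega> $ i) {j})"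
    by (rule indep_var_restrict) (use ij in auto)
  then have "indep_var borel ((\<lambda>f. f i) \<circ> (\<lambda>\<omega>. restrict (\<lambda>i. Z \<omega> $ i) {i}))
                       borel ((\<lambda>f. f j) \<circ> (\<lambda>\<omega>. restrict (\<lambda>i. Z \<omega> $ i) {j}))"
    by (rule indep_var_compose) auto
  then have "indep_var borel (\<lambda>\<omega>. Z \<omega> $ i) borel (\<lambda>\<omega>. Z \<omega> $ j)"
    by (simp add: o_def)
  then have joint: "?N \<Otimes>\<^sub>M ?N = distr M (borel \<Otimes>\<^sub>M borel) (\<lambda>\<omega>. (Z \<omega> $ i, Z \<omega> $ j))"
    by (simp add: indep_var_distribution_eq distr_standard_normal_component(2)[OF Z])
  let ?S = "{p. (fst p)\<^sup>2 + (snd p)\<^sup>2 > v\<^sup>2} :: (real \<times> real) set"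
  have S: "?S \<in> sets (borel \<Otimes>\<^sub>M borel)"
  proof -
    have "(\<lambda>p :: real \<times> real. (fst p)\<^sup>2 + (snd p)\<^sup>2) \<in> borel_measurable (borel \<Otimes>\<^sub>M borel)"
      by measurable
    from borel_measurable_less[OF borel_measurable_const this, of "v\<^sup>2"] show ?thesis
      by (simp add: space_pair_measure)
  qed
  have "exp (- v\<^sup>2 / 2) = measure (?N \<Otimes>\<^sub>M ?N) ?S"
    by (rule std_normal_plane_tail[OF v, symmetric])
  also have "\<dots> = measure M ((\<lambda>\<omega>. (Z \<omega> $ i, Z \<omega> $ j)) -` ?S \<inter> space M)"
    unfolding joint using S by (intro measure_distr) auto
  also have "\<dots> \<le> measure M {\<omega> \<in> space M. norm (Z \<omega>) > v}"
  proof (rule finite_measure_mono)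
    show "(\<lambda>\<omega>. (Z \<omega> $ i, Z \<omega> $ j)) -` ?S \<inter> space M \<subseteq> {\<omega> \<in> space M. norm (Z \<omega>) > v}"
    proof safe
      fix \<omega> assume "v\<^sup>2 < (fst (Z \<omega> $ i, Z \<omega> $ j))\<^sup>2 + (snd (Z \<omega> $ i, Z \<omega> $ j))\<^sup>2"
      then have "v\<^sup>2 < (\<Sum>k\<in>{i, j}. (Z \<omega> $ k)\<^sup>2)" using ij by simp
      also have "\<dots> \<le> (\<Sum>k\<in>UNIV. (Z \<omega> $ k)\<^sup>2)" by (rule sum_mono2) auto
      also have "\<dots> = (norm (Z \<omega>))\<^sup>2"
        by (simp add: norm_vec_def L2_set_def sum_nonneg)
      finally show "v < norm (Z \<omega>)" by (rule power2_less_imp_less) simp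
    qed
  qed measurable
  finally show ?thesis .
qed

text \<open>
  The conditional form of the theorem. The two cases behave differently: the exponential bound
  would fail, for large \<open>u\<close>, against the smaller one-dimensional Gaussian tail, which calls for the sharper
  real argument.
\<close>

lemma sign_mean_tail_less_gaussian:
  fixes Z :: "'a \<Rightarrow> real ^ 'd" and x :: "'i \<Rightarrow> real ^ 'd"
  assumes M: "prob_space M" and Z: "standard_normal_vector M Z"
    and A: "finite A" and u: "u \<ge> 0" and pos: "(\<Sum>i\<in>A. (norm (x i))\<^sup>2) > 0"
  shows "sign_mean A x (\<lambda>s. of_bool (norm s > u))
         < 2 * exp 3 / 9 * measure M {\<omega> \<in> space M. sqrt (\<Sum>i\<in>A. (norm (x i))\<^sup>2) * norm (Z \<omega>) > u}"
proof -
  interpret prob_space M by fact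
  define V where "V = (\<Sum>i\<in>A. (norm (x i))\<^sup>2)"
  define v where "v = u / sqrt V"
  have V: "V > 0" and v: "v \<ge> 0" using pos u by (auto simp: V_def v_def)
  have event: "{\<omega> \<in> space M. sqrt V * norm (Z \<omega>) > u} = {\<omega> \<in> space M. norm (Z \<omega>) > v}"
    using V by (auto simp: v_def divide_less_eq mult.commute)
  have "sign_mean A x (\<lambda>s. of_bool (norm s > u)) < 2 * exp 3 / 9 * measure M {\<omega> \<in> space M. norm (Z \<omega>) > v}"
  proof (cases "CARD('d) = 1")
    case True
    then obtain k :: 'd where k: "UNIV = {k}" by (auto simp: card_1_singleton_iff)
    have norm_eq: "norm z = \<bar>z $ k\<bar>" for z :: "real ^ 'd"
      unfolding norm_vec_def L2_set_def k by simp
    have "sign_mean A x (\<lambda>s. of_bool (norm s > u)) = sign_mean A (\<lambda>i. x i $ k) (\<lambda>t. of_bool (\<bar>t\<bar> > u))"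
      unfolding norm_eq
      by (rule sign_mean_linear_image[of "\<lambda>z. z $ k"]) (auto intro!: linearI)
    also have "\<dots> = 2 * sign_mean A (\<lambda>i. x i $ k) (\<lambda>t. of_bool (t > u))"
      by (rule sign_mean_two_sided_tail[OF A u])
    also have "\<dots> < 2 * exp 3 / 9 * (2 * gauss_tail v)"
      using sign_mean_upper_tail_less[OF A _ u, of "\<lambda>i. x i $ k"] V
      by (simp add: v_def V_def norm_eq)
    also have "2 * gauss_tail v = measure std_normal_distribution {z. \<bar>z\<bar> > v}"
      by (rule std_normal_abs_tail[OF v, symmetric])
    also have "\<dots> = measure M {\<omega> \<in> space M. norm (Z \<omega>) > v}"
      unfolding distr_standard_normal_component(2)[OF Z, of k, symmetric] norm_eq
      by (subst measure_distr) (auto simp: distr_standard_normal_component(1)[OF Z] intro!: arg_cong[of _ _ "measure M"])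
    finally show ?thesis .
  next
    case False
    have "sign_mean A x (\<lambda>s. of_bool (norm s > u)) \<le> 2 * exp (- u\<^sup>2 / (2 * V))"
      unfolding V_def by (rule sign_mean_norm_tail_le[OF A u pos])
    also have "- u\<^sup>2 / (2 * V) = - v\<^sup>2 / 2"
      using V by (simp add: v_def power_divide)
    also have "2 * exp (- v\<^sup>2 / 2) < 2 * exp 3 / 9 * exp (- v\<^sup>2 / 2)"
      by (intro mult_strict_right_mono tail_constant_greater_2) auto
    also have "\<dots> \<le> 2 * exp 3 / 9 * measure M {\<omega> \<in> space M. norm (Z \<omega>) > v}"
      by (intro mult_left_mono std_normal_vector_tail_ge[OF M Z False v]) auto
    finally show ?thesis .
  qed
  then show ?thesis unfolding V_def[symmetric] event .
qed

section \<open>Independent spherically invariant vectors\<close>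

text \<open>
  Symmetrization: by invariance under \<open>z \<mapsto> - z\<close> and independence, every family \<open>(\<plusminus> X\<^sub>i)\<close> has the same
  joint law as \<open>(X\<^sub>i)\<close>, so the probability may be averaged over all choices of signs.
\<close>

lemma prob_norm_sum_eq_sign_mean:
  fixes X :: "'i \<Rightarrow> 'a \<Rightarrow> real ^ 'd"
  assumes M: "prob_space M" and A: "finite A" "A \<noteq> {}"
    and inv: "\<And>i. i \<in> A \<Longrightarrow> spherically_invariant M (X i)"
    and indep: "prob_space.indep_vars M (\<lambda>_. borel) X A"
  shows "measure M {\<omega> \<in> space M. norm (\<Sum>i\<in>A. X i \<omega>) > u}
         = (\<integral>\<omega>. sign_mean A (\<lambda>i. X i \<omega>) (\<lambda>s. of_bool (norm s > u)) \<partial>M)"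
proof -
  interpret prob_space M by fact
  have [measurable]: "X i \<in> borel_measurable M" if "i \<in> A" for i
    using inv[OF that] by (simp add: spherically_invariant_def)
  define f :: "real ^ 'd \<Rightarrow> real" where "f s = of_bool (norm s > u)" for s
  have f_indicator: "f s = indicator {s. norm s > u} s" for s by (simp add: f_def)
  have [measurable]: "f \<in> borel_measurable borel"
    unfolding f_indicator[abs_def] by measurable
  have f_bound: "norm (f s) \<le> 1" for s by (simp add: f_def)
  \<comment> \<open>The family with the signs outside \<open>B\<close> reversed, and the common law \<open>P\<close> of all these families.\<close>
  define Y where "Y B i \<omega> = (if i \<in> B then X i \<omega> else - X i \<omega>)" for B i \<omega>
  have [measurable]: "Y B i \<in> borel_measurable M" if "i \<in> A" for B i
    unfolding Y_def using that by measurable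
  define P where "P = PiM A (\<lambda>i. distr M borel (X i))"
  have law: "distr M (PiM A (\<lambda>_. borel)) (\<lambda>\<omega>. \<lambda>i\<in>A. Y B i \<omega>) = P" for B
  proof -
    have "indep_vars (\<lambda>_. borel) (Y B) A"
      unfolding Y_def[abs_def] using indep_vars_compose2[OF indep, of "\<lambda>i z. if i \<in> B then z else - z" "\<lambda>_. borel"] by simp
    then have "distr M (PiM A (\<lambda>_. borel)) (\<lambda>\<omega>. \<lambda>i\<in>A. Y B i \<omega>) = PiM A (\<lambda>i. distr M borel (Y B i))"
      using A by (subst (asm) indep_vars_iff_distr_eq_PiM') auto
    also have "\<dots> = P"
      unfolding P_def
    proof (rule PiM_cong[OF refl])
      fix i assume i: "i \<in> A"
      have "orthogonal_transformation (\<lambda>z :: real ^ 'd. - z)"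
        by (simp add: orthogonal_transformation_neg orthogonal_transformation_id)
      then have "distr M borel (\<lambda>\<omega>. - X i \<omega>) = distr M borel (X i)"
        using inv[OF i] unfolding spherically_invariant_def by blast
      then show "distr M borel (Y B i) = distr M borel (X i)"
        by (cases "i \<in> B") (simp_all add: Y_def[abs_def])
    qed
    finally show ?thesis .
  qed
  have int: "integrable M (\<lambda>\<omega>. f (\<Sum>i\<in>A. Y B i \<omega>))" for B
    by (rule integrable_const_bound[of _ 1]) (use f_bound in auto)
  have E: "(\<integral>\<omega>. f (\<Sum>i\<in>A. Y B i \<omega>) \<partial>M) = (\<integral>w. f (\<Sum>i\<in>A. w i) \<partial>P)" for B
    unfolding law[of B, symmetric] by (subst integral_distr) (auto intro!: Bochner_Integration.integral_cong)
  have "(\<integral>\<omega>. sign_mean A (\<lambda>i. X i \<omega>) f \<partial>M) = (\<Sum>B\<in>Pow A. \<integral>\<omega>. f (\<Sum>i\<in>A. Y B i \<omega>) \<partial>M) / 2 ^ card A"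
    unfolding sign_mean_def using int by (simp add: Y_def[symmetric])
  also have "\<dots> = (\<integral>w. f (\<Sum>i\<in>A. w i) \<partial>P)"
    unfolding E using A by (simp add: card_Pow)
  also have "\<dots> = (\<integral>\<omega>. f (\<Sum>i\<in>A. Y A i \<omega>) \<partial>M)"
    by (rule E[symmetric])
  also have "\<dots> = (\<integral>\<omega>. indicator {\<omega> \<in> space M. norm (\<Sum>i\<in>A. X i \<omega>) > u} \<omega> \<partial>M)"
    by (intro Bochner_Integration.integral_cong) (auto simp: f_def Y_def indicator_def)
  finally show ?thesis
    by (simp add: f_def[abs_def])
qed

text \<open>
  Fubini's theorem for the independent pair of \<open>(X\<^sub>i)\<^sub>i\<close> and \<open>X\<^sub>k\<close>; the Gaussian vector enters as a
  member of the independent family, with an index \<open>k\<close> outside \<open>A\<close>.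
\<close>

lemma prob_independent_scale:
  fixes X :: "'i \<Rightarrow> 'a \<Rightarrow> 'v::{real_normed_vector,second_countable_topology}" and u :: real
  assumes M: "prob_space M" and A: "finite A" "k \<notin> A"
    and indep: "prob_space.indep_vars M (\<lambda>_. borel) X (insert k A)"
  defines "G \<equiv> \<lambda>x. measure M {\<omega> \<in> space M. sqrt (\<Sum>i\<in>A. (norm (x i))\<^sup>2) * norm (X k \<omega>) > u}"
  shows "measure M {\<omega> \<in> space M. sqrt (\<Sum>i\<in>A. (norm (X i \<omega>))\<^sup>2) * norm (X k \<omega>) > u}
         = (\<integral>\<omega>. G (\<lambda>i. X i \<omega>) \<partial>M)"
    and "integrable M (\<lambda>\<omega>. G (\<lambda>i. X i \<omega>))"
proof -
  interpret prob_space M by fact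
  let ?P = "PiM A (\<lambda>_. borel) :: ('i \<Rightarrow> 'v) measure"
  let ?Q = "PiM {k} (\<lambda>_. borel) :: ('i \<Rightarrow> 'v) measure"
  define W where "W = (\<lambda>\<omega>. \<lambda>i\<in>A. X i \<omega>)"
  define Z where "Z = (\<lambda>\<omega>. \<lambda>i\<in>{k}. X i \<omega>)"
  have "indep_var ?P W ?Q Z"
    unfolding W_def Z_def by (rule indep_var_restrict[OF indep]) (use A in auto)
  then have W[measurable]: "W \<in> measurable M ?P" and Z[measurable]: "Z \<in> measurable M ?Q"
    and joint: "distr M ?P W \<Otimes>\<^sub>M distr M ?Q Z = distr M (?P \<Otimes>\<^sub>M ?Q) (\<lambda>\<omega>. (W \<omega>, Z \<omega>))"
    by (auto simp: indep_var_distribution_eq)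
  interpret Z: prob_space "distr M ?Q Z" by (rule prob_space_distr) measurable
  let ?S = "{p \<in> space (?P \<Otimes>\<^sub>M ?Q). sqrt (\<Sum>i\<in>A. (norm (fst p i))\<^sup>2) * norm (snd p k) > u}"
  have S: "?S \<in> sets (?P \<Otimes>\<^sub>M ?Q)" by measurable
  have S': "?S \<in> sets (distr M ?P W \<Otimes>\<^sub>M distr M ?Q Z)"
    using S by (simp add: joint)
  have S'': "?S \<in> sets (?P \<Otimes>\<^sub>M distr M ?Q Z)"
    using S sets_pair_measure_cong[of ?P ?P "distr M ?Q Z" ?Q] by simp
  have section_eq: "measure (distr M ?Q Z) (Pair x -` ?S) = G x" if "x \<in> space ?P" for x
  proof -
    have "Pair x -` ?S \<in> sets ?Q" by (rule sets_Pair1[OF S])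
    then have "measure (distr M ?Q Z) (Pair x -` ?S) = measure M (Z -` (Pair x -` ?S) \<inter> space M)"
      by (intro measure_distr) measurable
    also have "Z -` (Pair x -` ?S) \<inter> space M = {\<omega> \<in> space M. sqrt (\<Sum>i\<in>A. (norm (x i))\<^sup>2) * norm (X k \<omega>) > u}"
      using that measurable_space[OF Z] by (auto simp: space_pair_measure Z_def)
    finally show ?thesis by (simp add: G_def)
  qed
  have GW: "G (W \<omega>) = G (\<lambda>i. X i \<omega>)" for \<omega>
    by (simp add: G_def W_def cong: sum.cong)
  have meas: "(\<lambda>x. measure (distr M ?Q Z) (Pair x -` ?S)) \<in> borel_measurable ?P"
    using Z.measurable_emeasure_Pair[OF S''] unfolding measure_def by measurable
  have [measurable]: "G \<in> borel_measurable ?P"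
    using meas by (subst measurable_cong[OF section_eq[symmetric]]) auto
  have G_bound: "norm (G x) \<le> 1" for x
    by (simp add: G_def)
  have int: "integrable M (\<lambda>\<omega>. G (W \<omega>))"
    by (rule integrable_const_bound[of _ 1]) (use G_bound in auto)
  then show "integrable M (\<lambda>\<omega>. G (\<lambda>i. X i \<omega>))"
    by (simp add: GW)
  have event: "(\<lambda>\<omega>. (W \<omega>, Z \<omega>)) -` ?S \<inter> space M
      = {\<omega> \<in> space M. sqrt (\<Sum>i\<in>A. (norm (X i \<omega>))\<^sup>2) * norm (X k \<omega>) > u}"
    using measurable_space[OF W] measurable_space[OF Z]
    by (auto simp: W_def Z_def space_pair_measure cong: sum.cong)
  have "emeasure M {\<omega> \<in> space M. sqrt (\<Sum>i\<in>A. (norm (X i \<omega>))\<^sup>2) * norm (X k \<omega>) > u}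
      = emeasure (distr M (?P \<Otimes>\<^sub>M ?Q) (\<lambda>\<omega>. (W \<omega>, Z \<omega>))) ?S"
    unfolding event[symmetric] by (rule emeasure_distr[OF _ S, symmetric]) measurable
  also have "\<dots> = (\<integral>\<^sup>+x. emeasure (distr M ?Q Z) (Pair x -` ?S) \<partial>distr M ?P W)"
    unfolding joint[symmetric] by (rule Z.emeasure_pair_measure_alt[OF S'])
  also have "\<dots> = (\<integral>\<^sup>+x. ennreal (G x) \<partial>distr M ?P W)"
    by (intro nn_integral_cong) (simp only: Z.emeasure_eq_measure section_eq space_distr)
  also have "\<dots> = (\<integral>\<^sup>+\<omega>. ennreal (G (W \<omega>)) \<partial>M)"
    by (subst nn_integral_distr) auto
  also have "\<dots> = ennreal (\<integral>\<omega>. G (W \<omega>) \<partial>M)"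
    by (rule nn_integral_eq_integral[OF int]) (simp add: G_def)
  finally show "measure M {\<omega> \<in> space M. sqrt (\<Sum>i\<in>A. (norm (X i \<omega>))\<^sup>2) * norm (X k \<omega>) > u}
         = (\<integral>\<omega>. G (\<lambda>i. X i \<omega>) \<partial>M)"
    by (simp add: GW measure_def) (simp add: G_def)
qed

theorem corollary1:
  fixes M :: "'a measure"
    and n :: nat
    and X :: "nat \<Rightarrow> 'a \<Rightarrow> real ^ 'd"
    and Z :: "'a \<Rightarrow> real ^ 'd"
    and u :: real
  assumes "prob_space M"
    and "n \<ge> 1"
    and "standard_normal_vector M Z"
    and "\<And>i. i \<in> {1..n} \<Longrightarrow> spherically_invariant M (X i)"
    and "prob_space.indep_vars M (\<lambda>_. borel) (X(0 := Z)) {0..n}"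
    and "u < 0 \<or> (\<exists>i\<in>{1..n}. \<not> (AE \<omega> in M. X i \<omega> = 0))"
  shows "\<P>(\<omega> in M. norm (\<Sum>i = 1..n. X i \<omega>) > u)
         < 2 * exp 3 / 9 *
           \<P>(\<omega> in M. sqrt (\<Sum>i = 1..n. (norm (X i \<omega>))\<^sup>2) * norm (Z \<omega>) > u)"
proof -
  interpret prob_space M by fact
  let ?A = "{1..n}"
  define c :: real where "c = 2 * exp 3 / 9"
  have c: "1 < c" using tail_constant_greater_2 by (simp add: c_def)
  show ?thesis
  proof (cases "u < 0")
    case True
    then have "{\<omega> \<in> space M. sqrt (\<Sum>i = 1..n. (norm (X i \<omega>))\<^sup>2) * norm (Z \<omega>) > u} = space M"
      by (auto intro: order.strict_trans2 simp: sum_nonneg)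
    then have "\<P>(\<omega> in M. sqrt (\<Sum>i = 1..n. (norm (X i \<omega>))\<^sup>2) * norm (Z \<omega>) > u) = 1"
      by (simp add: prob_space)
    then show ?thesis
      using le_less_trans[OF prob_le_1 c] by (simp only: c_def mult_1_right)
  next
    case False
    then have u: "u \<ge> 0" by simp
    have [measurable]: "X i \<in> borel_measurable M" if "i \<in> ?A" for i
      using assms(4)[OF that] by (simp add: spherically_invariant_def)
    have "indep_vars (\<lambda>_. borel) (X(0 := Z)) ?A"
      using assms(5) by (rule indep_vars_subset) auto
    then have indep_X: "indep_vars (\<lambda>_. borel) X ?A"
      by (rule indep_vars_cong[THEN iffD1, rotated -1]) auto
    have "insert 0 ?A = {0..n}" by auto
    then have indep: "indep_vars (\<lambda>_. borel) (X(0 := Z)) (insert 0 ?A)"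
      using assms(5) by simp
    have "(\<Sum>i\<in>?A. (norm ((X(0 := Z)) i \<omega>))\<^sup>2) = (\<Sum>i\<in>?A. (norm (X i \<omega>))\<^sup>2)" for \<omega>
      by (rule sum.cong) auto
    with prob_independent_scale[OF assms(1) _ _ indep, of u]
    have fubini: "measure M {\<omega> \<in> space M. sqrt (\<Sum>i\<in>?A. (norm (X i \<omega>))\<^sup>2) * norm (Z \<omega>) > u}
        = (\<integral>\<omega>'. measure M {\<omega> \<in> space M. sqrt (\<Sum>i\<in>?A. (norm (X i \<omega>'))\<^sup>2) * norm (Z \<omega>) > u} \<partial>M)"
      and integrable: "integrable M (\<lambda>\<omega>'. measure M {\<omega> \<in> space M. sqrt (\<Sum>i\<in>?A. (norm (X i \<omega>'))\<^sup>2) * norm (Z \<omega>) > u})"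
      by (simp_all del: fun_upd_apply add: fun_upd_same)
    define L where "L \<omega> = sign_mean ?A (\<lambda>i. X i \<omega>) (\<lambda>s. of_bool (norm s > u))" for \<omega>
    define G where "G x = measure M {\<omega> \<in> space M. sqrt (\<Sum>i\<in>?A. (norm (x i))\<^sup>2) * norm (Z \<omega>) > u}" for x :: "nat \<Rightarrow> real ^ 'd"
    \<comment> \<open>On \<open>E\<close> the conditional inequality is strict, off \<open>E\<close> both sides vanish; \<open>E\<close> has positive probability.\<close>
    define E where "E = {\<omega> \<in> space M. (\<Sum>i\<in>?A. (norm (X i \<omega>))\<^sup>2) > 0}"
    have less: "L \<omega> < c * G (\<lambda>i. X i \<omega>)" if "(\<Sum>i\<in>?A. (norm (X i \<omega>))\<^sup>2) > 0" for \<omega>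
      unfolding L_def G_def c_def
      by (rule sign_mean_tail_less_gaussian) (use assms u that in auto)
    have zero: "L \<omega> \<le> c * G (\<lambda>i. X i \<omega>)" if "\<not> (\<Sum>i\<in>?A. (norm (X i \<omega>))\<^sup>2) > 0" for \<omega>
    proof -
      have "(\<Sum>i\<in>?A. (norm (X i \<omega>))\<^sup>2) = 0"
        using that by (simp add: not_less antisym sum_nonneg)
      then have "\<forall>i\<in>?A. X i \<omega> = 0" by (subst (asm) sum_nonneg_eq_0_iff) auto
      then have "(\<Sum>i\<in>?A. if i \<in> B then X i \<omega> else - X i \<omega>) = 0" for B
        by (intro sum.neutral) auto
      then have "L \<omega> = 0" using u by (simp add: L_def sign_mean_def)
      then show ?thesis using c by (simp add: G_def)
    qed
    have "(\<integral>\<omega>. L \<omega> \<partial>M) < (\<integral>\<omega>. c * G (\<lambda>i. X i \<omega>) \<partial>M)"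
    proof (rule integral_less_AE[of _ _ E])
      show "integrable M L"
      proof (rule integrable_const_bound[of _ 1])
        have "0 \<le> L \<omega>" for \<omega> by (simp add: L_def sign_mean_def sum_nonneg)
        moreover have "L \<omega> \<le> sign_mean ?A (\<lambda>i. X i \<omega>) (\<lambda>s. 1)" for \<omega>
          unfolding L_def by (rule sign_mean_mono) simp
        ultimately show "AE \<omega> in M. norm (L \<omega>) \<le> 1" by (simp add: sign_mean_const)
        have ind: "of_bool (norm s > u) = (indicator {s. norm s > u} s :: real)" for s :: "real ^ 'd"
          by simp
        show "L \<in> borel_measurable M"
          unfolding L_def[abs_def] sign_mean_def ind by measurable
      qed
      show "integrable M (\<lambda>\<omega>. c * G (\<lambda>i. X i \<omega>))"
        unfolding G_def using integrable by (rule integrable_mult_right)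
      show "E \<in> sets M" unfolding E_def by measurable
      show "emeasure M E \<noteq> 0"
      proof
        assume "emeasure M E = 0"
        with \<open>E \<in> sets M\<close> have "AE \<omega> in M. \<omega> \<notin> E" by (intro AE_not_in null_setsI)
        then have "AE \<omega> in M. X i \<omega> = 0" if i: "i \<in> ?A" for i
          using AE_space
        proof eventually_elim
          case (elim \<omega>)
          have "(norm (X i \<omega>))\<^sup>2 \<le> (\<Sum>i\<in>?A. (norm (X i \<omega>))\<^sup>2)"
            using i by (intro member_le_sum) auto
          also have "\<dots> \<le> 0" using elim by (simp add: E_def)
          finally show ?case by simp
        qed
        with assms(6) u show False by auto
      qed
      show "AE \<omega> in M. \<omega> \<in> E \<longrightarrow> L \<omega> \<noteq> c * G (\<lambda>i. X i \<omega>)"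
        using less by (intro AE_I2) (force simp: E_def)
      show "AE \<omega> in M. L \<omega> \<le> c * G (\<lambda>i. X i \<omega>)"
        using less zero by (intro AE_I2) (meson less_imp_le)
    qed
    moreover have "\<P>(\<omega> in M. norm (\<Sum>i = 1..n. X i \<omega>) > u) = (\<integral>\<omega>. L \<omega> \<partial>M)"
      unfolding L_def using assms(2)
      by (intro prob_norm_sum_eq_sign_mean assms(1,4) indep_X) auto
    moreover have "\<P>(\<omega> in M. sqrt (\<Sum>i = 1..n. (norm (X i \<omega>))\<^sup>2) * norm (Z \<omega>) > u) = (\<integral>\<omega>. G (\<lambda>i. X i \<omega>) \<partial>M)"
      unfolding G_def by (rule fubini)
    ultimately show ?thesis by (simp add: c_def)
  qed
qed

end
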